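(* Let $\Omega=\mathbb{R}^d/\mathbb{Z}^d$, let $h:\Omega\to\mathbb{R}$ be continuous with $\hat h(\xi)\ne0$ for all $\xi\in\mathbb{Z}^d$, and let $\pi$ be a probability measure on $\Omega$. Let $T>0$. For any integer $m\geq 1$ and any positive reals $\alpha_1,\dots,\alpha_m$, the problem $$\inf_{\mu\in\mathcal{M}(\mathcal{P}_T^{m,\infty})}\mathcal{N}_h(\mu-\pi)$$ admits at least one solution in $\mathcal{M}(\mathcal{P}_T^{m,\infty})$.
   Context: $\mathcal{N}_h(\mu)=\|h\star\mu\|_{L^2(\Omega)}$ with $h\star\mu(x)=\int_\Omega h(x-y)\,d\mu(y)$; $\hat h(\xi)=\int_\Omega e^{-2i\pi\langle\xi,x\rangle}h(x)\,dx$. $\mathcal{P}_T^{m,\infty}$ is the set of curves $p:[0,T]\to\Omega$ of Sobolev class $W^{m,\infty}$ (i.e. possessing a continuous lift to $\mathbb{R}^d$ in $(W^{m,\infty}([0,T]))^d$) such that $\|p^{(i)}\|_\infty\leq\alpha_i$ for all $i\in\{1,\dots,m\}$, where $p^{(i)}$ is the $i$-th derivative (of the lift) and $\|\cdot\|_\infty$ is the essential supremum over $[0,T]$ of the Euclidean norm. $\gamma_T$ is the normalized Lebesgue measure on $[0,T]$ (total mass 1), $p_*\gamma_T(B)=\gamma_T(p^{-1}(B))$ is the pushforward, and $\mathcal{M}(\mathcal{P}_T^{m,\infty})=\{p_*\gamma_T:\ p\in\mathcal{P}_T^{m,\infty}\}$. *)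

theory Defs
  imports "HOL-Probability.Probability"
begin
quotient_type 'd torus = "real ^ ('d::finite)" / "\<lambda>x y. \<forall>i. x $ i - y $ i \<in> \<int>"
proof (rule equivpI)
  show "reflp (\<lambda>x y :: real ^ 'd. \<forall>i. x $ i - y $ i \<in> \<int>)"
    by (simp add: reflp_def)
  show "symp (\<lambda>x y :: real ^ 'd. \<forall>i. x $ i - y $ i \<in> \<int>)"
  proof (rule sympI, rule allI)
    fix x y :: "real ^ 'd" and i
    assume "\<forall>i. x $ i - y $ i \<in> \<int>"
    then have "- (x $ i - y $ i) \<in> \<int>"
      using Ints_minus by blast
    then show "y $ i - x $ i \<in> \<int>" by simp
  qed
  show "transp (\<lambda>x y :: real ^ 'd. \<forall>i. x $ i - y $ i \<in> \<int>)"
  proof (rule transpI, rule allI)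
    fix x y z :: "real ^ 'd" and i
    assume "\<forall>i. x $ i - y $ i \<in> \<int>" "\<forall>i. y $ i - z $ i \<in> \<int>"
    then have "(x $ i - y $ i) + (y $ i - z $ i) \<in> \<int>"
      by (intro Ints_add) auto
    then show "x $ i - z $ i \<in> \<int>" by simp
  qed
qed

lift_definition torus_proj :: "real ^ 'd \<Rightarrow> ('d::finite) torus" is "\<lambda>x. x" .

instantiation torus :: (finite) ab_group_add
begin

lift_definition zero_torus :: "'a torus" is "0 :: real ^ 'a" .

lift_definition plus_torus :: "'a torus \<Rightarrow> 'a torus \<Rightarrow> 'a torus"
  is "(+) :: real ^ 'a \<Rightarrow> real ^ 'a \<Rightarrow> real ^ 'a"
proof -
  fix x x' y y' :: "real ^ 'a" and i
  assume "\<And>i. x $ i - x' $ i \<in> \<int>" "\<And>i. y $ i - y' $ i \<in> \<int>"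
  then have "(x $ i - x' $ i) + (y $ i - y' $ i) \<in> \<int>"
    using Ints_add by blast
  then show "(x + y) $ i - (x' + y') $ i \<in> \<int>"
    by (simp add: algebra_simps)
qed

lift_definition uminus_torus :: "'a torus \<Rightarrow> 'a torus" is "uminus :: real ^ 'a \<Rightarrow> real ^ 'a"
proof -
  fix x x' :: "real ^ 'a" and i
  assume "\<And>i. x $ i - x' $ i \<in> \<int>"
  then have "- (x $ i - x' $ i) \<in> \<int>"
    using Ints_minus by blast
  then show "(- x) $ i - (- x') $ i \<in> \<int>"
    by simp
qed

lift_definition minus_torus :: "'a torus \<Rightarrow> 'a torus \<Rightarrow> 'a torus"
  is "(-) :: real ^ 'a \<Rightarrow> real ^ 'a \<Rightarrow> real ^ 'a"
proof -
  fix x x' y y' :: "real ^ 'a" and i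
  assume "\<And>i. x $ i - x' $ i \<in> \<int>" "\<And>i. y $ i - y' $ i \<in> \<int>"
  then have "(x $ i - x' $ i) - (y $ i - y' $ i) \<in> \<int>"
    using Ints_diff by blast
  then show "(x - y) $ i - (x' - y') $ i \<in> \<int>"
    by (simp add: algebra_simps)
qed

instance
  by standard (transfer; simp add: algebra_simps)+

end

instantiation torus :: (finite) topological_space
begin

definition open_torus :: "'a torus set \<Rightarrow> bool"
  where "open_torus U \<longleftrightarrow> open (torus_proj -` U)"

instance
  by standard (auto simp: open_torus_def vimage_Union)

end

definition torus_lebesgue :: "('d::finite) torus measure"
  where "torus_lebesgue =
    distr (restrict_space lborel {x. \<forall>i. 0 \<le> x $ i \<and> x $ i < 1}) borel torus_proj"

lift_definition torus_char :: "int ^ 'd \<Rightarrow> ('d::finite) torus \<Rightarrow> complex"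
  is "\<lambda>\<xi> x. exp (- 2 * \<i> * of_real pi * of_real (\<Sum>j\<in>UNIV. of_int (\<xi> $ j) * x $ j))"
proof -
  fix \<xi> :: "int ^ 'd" and x y :: "real ^ 'd"
  assume *: "\<And>i. x $ i - y $ i \<in> \<int>"
  have "(\<Sum>j\<in>UNIV. of_int (\<xi> $ j) * x $ j) - (\<Sum>j\<in>UNIV. of_int (\<xi> $ j) * y $ j)
      = (\<Sum>j\<in>UNIV. of_int (\<xi> $ j) * (x $ j - y $ j))"
    by (simp add: sum_subtractf algebra_simps)
  also have "\<dots> \<in> \<int>"
    using * by (intro Ints_sum Ints_mult) auto
  finally obtain k :: int where
    k: "(\<Sum>j\<in>UNIV. of_int (\<xi> $ j) * x $ j)
      = (\<Sum>j\<in>UNIV. of_int (\<xi> $ j) * y $ j) + of_int k"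
    by (metis Ints_cases diff_add_cancel add.commute)
  show "exp (- 2 * \<i> * of_real pi * of_real (\<Sum>j\<in>UNIV. of_int (\<xi> $ j) * x $ j))
      = exp (- 2 * \<i> * of_real pi * of_real (\<Sum>j\<in>UNIV. of_int (\<xi> $ j) * y $ j))"
    unfolding k exp_eq
    by (intro exI[of _ "- k"]) (simp add: algebra_simps)
qed

definition fourier_coeff :: "(('d::finite) torus \<Rightarrow> real) \<Rightarrow> int ^ 'd \<Rightarrow> complex"
  where "fourier_coeff h \<xi> = (\<integral>x. torus_char \<xi> x * complex_of_real (h x) \<partial>torus_lebesgue)"

text \<open>A finite signed Borel measure is represented by its set function, so that
  \<^term>\<open>measure \<mu> - measure \<nu>\<close> is the difference of two finite Borel measures. Integrals are
  taken against the Jordan decomposition; the coercion \<^term>\<open>ennreal\<close> sends negative reals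
  to \<open>0\<close>, which is harmless here since the empty set is among the competitors.\<close>

definition pos_variation :: "('a::topological_space set \<Rightarrow> real) \<Rightarrow> 'a measure"
  where "pos_variation \<sigma> =
    measure_of UNIV (sets borel) (\<lambda>A. SUP B\<in>{B \<in> sets borel. B \<subseteq> A}. ennreal (\<sigma> B))"

definition signed_integral :: "('a::topological_space set \<Rightarrow> real) \<Rightarrow> ('a \<Rightarrow> real) \<Rightarrow> real"
  where "signed_integral \<sigma> f =
    (\<integral>x. f x \<partial>pos_variation \<sigma>) - (\<integral>x. f x \<partial>pos_variation (- \<sigma>))"

definition torus_conv :: "(('d::finite) torus \<Rightarrow> real) \<Rightarrow> ('d torus set \<Rightarrow> real) \<Rightarrow> 'd torus \<Rightarrow> real"
    (infixl "\<star>" 70)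
  where "(h \<star> \<sigma>) x = signed_integral \<sigma> (\<lambda>y. h (x - y))"

definition L2_norm :: "(('d::finite) torus \<Rightarrow> real) \<Rightarrow> real"
  where "L2_norm f = sqrt (\<integral>x. (f x)\<^sup>2 \<partial>torus_lebesgue)"

definition conv_norm :: "(('d::finite) torus \<Rightarrow> real) \<Rightarrow> ('d torus set \<Rightarrow> real) \<Rightarrow> real"
  where "conv_norm h \<sigma> = L2_norm (h \<star> \<sigma>)"

definition ess_norm :: "real \<Rightarrow> (real \<Rightarrow> 'b::euclidean_space) \<Rightarrow> ereal"
  where "ess_norm T f = esssup (lebesgue_on {0..T}) (\<lambda>t. ereal (norm (f t)))"

definition L_infty :: "real \<Rightarrow> (real \<Rightarrow> real) set"
  where "L_infty T = {f \<in> borel_measurable (lebesgue_on {0..T}). ess_norm T f < \<infinity>}"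

definition test_function :: "real \<Rightarrow> (real \<Rightarrow> real) \<Rightarrow> bool"
  where "test_function T \<phi> \<longleftrightarrow>
    (\<forall>k. (deriv ^^ k) \<phi> differentiable_on UNIV) \<and>
    compact (closure {t. \<phi> t \<noteq> 0}) \<and> closure {t. \<phi> t \<noteq> 0} \<subseteq> {0<..<T}"

text \<open>Only used for \<open>f\<close> and \<open>g\<close> in \<^term>\<open>L_infty T\<close>, so all integrands are integrable.\<close>

definition has_weak_deriv :: "real \<Rightarrow> nat \<Rightarrow> (real \<Rightarrow> real) \<Rightarrow> (real \<Rightarrow> real) \<Rightarrow> bool"
  where "has_weak_deriv T i f g \<longleftrightarrow>
    (\<forall>\<phi>. test_function T \<phi> \<longrightarrow>
      (\<integral>t. f t * (deriv ^^ i) \<phi> t \<partial>lebesgue_on {0..T})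
        = (- 1) ^ i * (\<integral>t. g t * \<phi> t \<partial>lebesgue_on {0..T}))"

definition sobolev_infty :: "real \<Rightarrow> nat \<Rightarrow> (real \<Rightarrow> real) set"
  where "sobolev_infty T m =
    {f \<in> L_infty T. \<forall>i\<in>{1..m}. \<exists>g\<in>L_infty T. has_weak_deriv T i f g}"

text \<open>Curves are total functions on \<^typ>\<open>real\<close>, only their values on \<open>[0, T]\<close> matter.
  In the definition, \<open>q\<close> is the lift and \<open>g\<close> its \<open>i\<close>-th weak derivative, which is unique
  up to null sets and does not depend on the choice of the lift.\<close>

definition curves :: "real \<Rightarrow> nat \<Rightarrow> (nat \<Rightarrow> real) \<Rightarrow> (real \<Rightarrow> ('d::finite) torus) set"
  where "curves T m \<alpha> = {p. \<exists>q :: real \<Rightarrow> real ^ 'd.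
    continuous_on {0..T} q \<and> (\<forall>t\<in>{0..T}. p t = torus_proj (q t)) \<and>
    (\<forall>j. (\<lambda>t. q t $ j) \<in> sobolev_infty T m) \<and>
    (\<forall>i\<in>{1..m}. \<exists>g :: real \<Rightarrow> real ^ 'd.
      (\<forall>j. (\<lambda>t. g t $ j) \<in> L_infty T \<and> has_weak_deriv T i (\<lambda>t. q t $ j) (\<lambda>t. g t $ j)) \<and>
      ess_norm T g \<le> ereal (\<alpha> i))}"

definition normalized_lebesgue :: "real \<Rightarrow> real measure"
  where "normalized_lebesgue T = uniform_measure (lebesgue_on {0..T}) {0..T}"

definition curve_measures :: "real \<Rightarrow> nat \<Rightarrow> (nat \<Rightarrow> real) \<Rightarrow> ('d::finite) torus measure set"
  where "curve_measures T m \<alpha> = (\<lambda>p. distr (normalized_lebesgue T) borel p) ` curves T m \<alpha>"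

end

theory Submission
  imports Defs "HOL-Complex_Analysis.Great_Picard"
begin

text \<open>Direct method. A minimizing sequence of curves is normalized by integer translations of its
  lifts. A continuous function with a first weak derivative bounded by \<open>\<alpha> 1\<close> is Lipschitz (test
  the weak derivative against smooth plateaus), so the lifts converge uniformly along a
  subsequence, by Arzela-Ascoli. The weak derivatives of each order lie in a ball of \<open>L\<^sup>\<infinity>\<close>, which
  is sequentially weak-* compact, and the defining identity of weak derivatives passes to the
  limit. The discrepancy is continuous for pointwise convergence of curves, by dominated
  convergence.\<close>

section \<open>Integration against differences of measures\<close>

text \<open>Three points shape the proof. The discrepancy is built from the Jordan decomposition of
  a set function, so the convolution must first be rewritten as a difference of two ordinary
  integrals before dominated convergence applies to it. The constraints bound the Euclidean norm of
  a vector-valued derivative, so a limit taken coordinate by coordinate would lose a dimensional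
  factor; the sharp bound is recovered as the Lipschitz constant of the limit of the vector-valued
  primitives. Finally, the orders \<open>1..m\<close> are decoupled: for each \<open>i\<close> the
  weak derivative is a separate function, tied to the lift only by an identity in which all
  \<open>i\<close> derivatives fall on the test function. Hence finitely many independent
  extractions suffice, and nothing has to be proved about how the limits of different orders are
  related.\<close>

lemma nn_integral_add_measure_cong:
  assumes sets: "sets N = sets M" "sets P = sets M" "sets Q = sets M"
    and eq: "\<And>A. A \<in> sets M \<Longrightarrow> emeasure P A + emeasure N A = emeasure Q A + emeasure M A"
    and f: "f \<in> borel_measurable M"
  shows "(\<integral>\<^sup>+x. f x \<partial>P) + (\<integral>\<^sup>+x. f x \<partial>N) = (\<integral>\<^sup>+x. f x \<partial>Q) + (\<integral>\<^sup>+x. f x \<partial>M)"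
  using f
proof (induction f rule: borel_measurable_induct)
  case (cong f g)
  have "nn_integral L f = nn_integral L g" if "space L = space M" for L
    using cong(3) that by (intro nn_integral_cong) auto
  then show ?case
    using cong(4) sets[THEN sets_eq_imp_space_eq] by (simp add: cong_def)
next
  case (set A)
  then show ?case using eq[of A] sets by simp
next
  case (mult u c)
  note [measurable_cong] = sets
  have [measurable]: "u \<in> borel_measurable M" by fact
  show ?case
    using arg_cong[OF mult.IH, of "\<lambda>x. c * x"] by (simp add: nn_integral_cmult distrib_left)
next
  case (add u v)
  note [measurable_cong] = sets
  have [measurable]: "u \<in> borel_measurable M" "v \<in> borel_measurable M" by fact+
  show ?case
    using add.IH by (simp add: nn_integral_add) (metis (no_types, lifting) add.assoc add.commute)
next
  case (seq U)
  note [measurable_cong] = sets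
  have [measurable]: "U i \<in> borel_measurable M" for i by fact
  have inc: "incseq (\<lambda>i. nn_integral L (U i))" for L
    using \<open>incseq U\<close> by (auto simp: incseq_def le_fun_def intro!: nn_integral_mono)
  have mono: "nn_integral L (\<lambda>x. (SUP i. U i) x) = (SUP i. nn_integral L (U i))" if "sets L = sets M" for L
  proof -
    have "U i \<in> borel_measurable L" for i
      using that by (simp cong: measurable_cong_sets)
    then show ?thesis
      unfolding SUP_apply using \<open>incseq U\<close> by (intro nn_integral_monotone_convergence_SUP) auto
  qed
  show ?case
    unfolding mono[OF refl] mono[OF sets(1)] mono[OF sets(2)] mono[OF sets(3)]
    by (simp add: seq.IH ennreal_SUP_add[OF inc inc, symmetric])
qed

text \<open>\<open>Y\<close> is a positive set of a Hahn decomposition for \<open>M - N\<close>.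
  Among the measurable subsets of \<open>A\<close>, the value of \<open>M - N\<close> is largest on
  \<open>A \<inter> Y\<close>, so the supremum in the definition is attained there.\<close>

lemma emeasure_pos_variation:
  fixes M N :: "'a::topological_space measure"
  assumes M: "finite_measure M" "sets M = sets borel" and N: "finite_measure N" "sets N = sets borel"
    and Y: "Y \<in> sets borel" "\<And>X. X \<in> sets borel \<Longrightarrow> X \<subseteq> Y \<Longrightarrow> emeasure N X \<le> emeasure M X"
      "\<And>X. X \<in> sets borel \<Longrightarrow> X \<inter> Y = {} \<Longrightarrow> emeasure M X \<le> emeasure N X"
    and A: "A \<in> sets borel"
  shows "emeasure (pos_variation (measure M - measure N)) A = emeasure M (A \<inter> Y) - emeasure N (A \<inter> Y)"
proof -
  interpret M: finite_measure M by fact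
  interpret N: finite_measure N by fact
  have sp: "space M = UNIV" "space N = UNIV"
    using M(2) N(2) by (metis sets_eq_imp_space_eq space_borel)+
  have le: "measure N X \<le> measure M X" if "X \<in> sets borel" "X \<subseteq> Y" for X
    using Y(2)[OF that] by (simp add: M.emeasure_eq_measure N.emeasure_eq_measure)
  have ge: "measure M X \<le> measure N X" if "X \<in> sets borel" "X \<inter> Y = {}" for X
    using Y(3)[OF that] by (simp add: M.emeasure_eq_measure N.emeasure_eq_measure)
  let ?s = "measure M - measure N"
  \<comment> \<open>\<open>measure_of\<close> returns the prescribed set function only when it is
    countably additive. Matching it with the \<open>emeasure\<close> of a measure that already
    exists settles this without a direct proof.\<close>
  define P where "P = diff_measure (density M (indicator Y)) (density N (indicator Y))"
  have setsP: "sets P = sets borel" "space P = UNIV"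
    by (auto simp: P_def M sp)
  have emP: "emeasure P B = emeasure M (B \<inter> Y) - emeasure N (B \<inter> Y)" if "B \<in> sets borel" for B
  proof -
    have ind: "emeasure (density L (indicator Y)) C = emeasure L (C \<inter> Y)"
      if "sets L = sets borel" "C \<in> sets borel" for C and L :: "'a measure"
    proof -
      have "emeasure (density L (indicator Y)) C = (\<integral>\<^sup>+x. indicator Y x * indicator C x \<partial>L)"
        using that Y(1) by (intro emeasure_density) (auto cong: measurable_cong_sets)
      also have "\<dots> = (\<integral>\<^sup>+x. indicator (C \<inter> Y) x \<partial>L)"
        by (intro nn_integral_cong) (auto split: split_indicator)
      also have "\<dots> = emeasure L (C \<inter> Y)" using that Y(1) by (intro nn_integral_indicator) auto
      finally show ?thesis .
    qed
    have "finite_measure (density L (indicator Y))" if "finite_measure L" "sets L = sets borel" for L :: "'a measure"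
    proof -
      have "space L = UNIV" using that(2) by (metis sets_eq_imp_space_eq space_borel)
      with that show ?thesis
        by (intro finite_measureI) (simp add: ind finite_measure.emeasure_finite)
    qed
    then show ?thesis
      unfolding P_def using that M N Y
      by (subst emeasure_diff_measure) (auto simp: ind)
  qed
  have "(SUP X\<in>{X \<in> sets borel. X \<subseteq> B}. ennreal (?s X)) = emeasure P B" if B: "B \<in> sets borel" for B
  proof -
    have eqB: "emeasure P B = ennreal (?s (B \<inter> Y))"
      using emP[OF B] by (simp add: M.emeasure_eq_measure N.emeasure_eq_measure ennreal_minus)
    show ?thesis
    proof (rule antisym)
      show "(SUP X\<in>{X \<in> sets borel. X \<subseteq> B}. ennreal (?s X)) \<le> emeasure P B"
      proof (rule SUP_least)
        fix X assume "X \<in> {X \<in> sets borel. X \<subseteq> B}"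
        then have X: "X \<in> sets borel" "X \<subseteq> B" by auto
        \<comment> \<open>Passing from \<open>X\<close> to \<open>B \<inter> Y\<close> discards
          \<open>X - Y\<close>, where \<open>N\<close> dominates, and adds
          \<open>B \<inter> Y - X\<close>, where \<open>M\<close> dominates; both moves increase
          \<open>M - N\<close>.\<close>
        have split: "measure L X = measure L (X \<inter> Y) + measure L (X - Y)"
          "measure L (B \<inter> Y) = measure L (X \<inter> Y) + measure L (B \<inter> Y - X)"
          if "finite_measure L" "sets L = sets borel" for L
        proof -
          interpret L: finite_measure L by fact
          show "measure L X = measure L (X \<inter> Y) + measure L (X - Y)"
            using X Y(1) that by (subst L.finite_measure_Union[symmetric]) (auto simp: Un_Diff_Int Int_commute intro!: arg_cong[where f="measure L"])
          show "measure L (B \<inter> Y) = measure L (X \<inter> Y) + measure L (B \<inter> Y - X)"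
            using X Y(1) B that by (subst L.finite_measure_Union[symmetric]) (auto intro!: arg_cong[where f="measure L"])
        qed
        have "measure M (X - Y) \<le> measure N (X - Y)" "measure N (B \<inter> Y - X) \<le> measure M (B \<inter> Y - X)"
          using X Y(1) B by (auto intro!: le ge)
        then have "?s X \<le> ?s (B \<inter> Y)"
          using split[OF M] split[OF N] by simp
        then show "ennreal (?s X) \<le> emeasure P B"
          unfolding eqB by (rule ennreal_leI)
      qed
      show "emeasure P B \<le> (SUP X\<in>{X \<in> sets borel. X \<subseteq> B}. ennreal (?s X))"
        unfolding eqB using B Y(1) by (intro SUP_upper) auto
    qed
  qed
  then have "pos_variation ?s = measure_of UNIV (sets borel) (emeasure P)"
    unfolding pos_variation_def using sets.sigma_sets_eq[of "borel :: 'a measure"]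
    by (intro measure_of_eq) auto
  also have "\<dots> = P"
    using measure_of_of_measure[of P] setsP by simp
  finally show ?thesis using emP[OF A] by simp
qed

lemma sets_pos_variation [simp]: "sets (pos_variation \<sigma>) = sets borel"
  and space_pos_variation [simp]: "space (pos_variation \<sigma>) = UNIV"
  using sets.sigma_sets_eq[of borel] by (auto simp: pos_variation_def sets_measure_of_conv space_measure_of_conv)

text \<open>The Jordan parts differ from \<open>M\<close> and \<open>N\<close> by a common piece,
  which cancels. This replaces the variations by the two given measures in every later
  computation.\<close>

proposition signed_integral_diff_measure:
  fixes M N :: "'a::topological_space measure"
  assumes M: "finite_measure M" "sets M = sets borel" and N: "finite_measure N" "sets N = sets borel"
    and f: "f \<in> borel_measurable borel" "\<And>x. \<bar>f x\<bar> \<le> C"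
  shows "signed_integral (measure M - measure N) f = (\<integral>x. f x \<partial>M) - (\<integral>x. f x \<partial>N)"
proof -
  interpret M: finite_measure M by fact
  interpret N: finite_measure N by fact
  obtain Y where Y: "Y \<in> sets borel" "\<And>X. X \<in> sets borel \<Longrightarrow> X \<subseteq> Y \<Longrightarrow> emeasure N X \<le> emeasure M X"
      "\<And>X. X \<in> sets borel \<Longrightarrow> X \<inter> Y = {} \<Longrightarrow> emeasure M X \<le> emeasure N X"
    using finite_unsigned_Hahn_decomposition[OF M(1) N(1)] M N by auto
  let ?P = "pos_variation (measure M - measure N)" and ?Q = "pos_variation (- (measure M - measure N))"
  have emP: "emeasure ?P A = emeasure M (A \<inter> Y) - emeasure N (A \<inter> Y)" if "A \<in> sets borel" for A
    by (rule emeasure_pos_variation[OF M N Y that])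
  have emQ: "emeasure ?Q A = emeasure N (A - Y) - emeasure M (A - Y)" if "A \<in> sets borel" for A
  proof -
    have "emeasure (pos_variation (measure N - measure M)) A
        = emeasure N (A \<inter> (- Y)) - emeasure M (A \<inter> (- Y))"
      using Y that by (intro emeasure_pos_variation[OF N M]) auto
    moreover have "- (measure M - measure N) = measure N - measure M"
      by (simp add: fun_eq_iff)
    ultimately show ?thesis by (simp add: Diff_eq)
  qed
  \<comment> \<open>The identity P - Q = M - N in additive form, since truncated subtraction in
    \<open>ennreal\<close> does not cancel freely. It is checked separately on
    \<open>A \<inter> Y\<close>, where \<open>?Q\<close> vanishes, and on \<open>A - Y\<close>,
    where \<open>?P\<close> vanishes.\<close>
  have add: "emeasure ?P A + emeasure N A = emeasure ?Q A + emeasure M A" if A: "A \<in> sets borel" for A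
  proof -
    have sM: "emeasure L A = emeasure L (A \<inter> Y) + emeasure L (A - Y)" if "sets L = sets borel" for L
      using A Y(1) that by (subst plus_emeasure) (auto intro!: arg_cong[where f="emeasure L"])
    have 1: "emeasure M (A \<inter> Y) - emeasure N (A \<inter> Y) + emeasure N (A \<inter> Y) = emeasure M (A \<inter> Y)"
      using A Y by (intro diff_add_cancel_ennreal) auto
    have 2: "emeasure N (A - Y) - emeasure M (A - Y) + emeasure M (A - Y) = emeasure N (A - Y)"
      using A Y(1) Y(3)[of "A - Y"] by (intro diff_add_cancel_ennreal) auto
    have "emeasure ?P A + emeasure N A = emeasure M (A \<inter> Y) + emeasure N (A - Y)"
      using 1 by (simp add: emP A sM[OF N(2)] add.assoc[symmetric])
    also have "\<dots> = emeasure ?Q A + emeasure M A"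
      using 2 by (simp add: emQ A sM[OF M(2)])
    finally show ?thesis .
  qed
  have fin: "finite_measure ?P" "finite_measure ?Q"
    by (auto intro!: finite_measureI simp: emP emQ ennreal_minus_eq_top)
  have int: "integrable L f" if "finite_measure L" "sets L = sets borel" for L
    using that f by (intro finite_measure.integrable_const_bound[of _ _ C]) (auto cong: measurable_cong_sets)
  \<comment> \<open>The coercion to \<open>ennreal\<close> clips negative values, so this is applied
    to \<open>f\<close> and to \<open>- f\<close>, and the Bochner integrals are recombined from the
    two parts.\<close>
  have *: "(\<integral>\<^sup>+x. g x \<partial>?P) + (\<integral>\<^sup>+x. g x \<partial>N) = (\<integral>\<^sup>+x. g x \<partial>?Q) + (\<integral>\<^sup>+x. g x \<partial>M)"
    if "g \<in> borel_measurable borel" for g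
    using that M(2) N(2) by (intro nn_integral_add_measure_cong) (auto simp: add cong: measurable_cong_sets)
  have "(\<integral>\<^sup>+x. ennreal (f x) \<partial>?P) + (\<integral>\<^sup>+x. ennreal (f x) \<partial>N) = (\<integral>\<^sup>+x. ennreal (f x) \<partial>?Q) + (\<integral>\<^sup>+x. ennreal (f x) \<partial>M)"
    "(\<integral>\<^sup>+x. ennreal (- f x) \<partial>?P) + (\<integral>\<^sup>+x. ennreal (- f x) \<partial>N) = (\<integral>\<^sup>+x. ennreal (- f x) \<partial>?Q) + (\<integral>\<^sup>+x. ennreal (- f x) \<partial>M)"
    using f(1) by (auto intro!: *)
  moreover obtain rP qP where "0 \<le> rP" "0 \<le> qP" "(\<integral>\<^sup>+x. ennreal (f x) \<partial>?P) = ennreal rP"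
    "(\<integral>\<^sup>+x. ennreal (- f x) \<partial>?P) = ennreal qP" "integral\<^sup>L ?P f = rP - qP"
    using int[OF fin(1)] by (auto elim!: integrableE)
  moreover obtain rQ qQ where "0 \<le> rQ" "0 \<le> qQ" "(\<integral>\<^sup>+x. ennreal (f x) \<partial>?Q) = ennreal rQ"
    "(\<integral>\<^sup>+x. ennreal (- f x) \<partial>?Q) = ennreal qQ" "integral\<^sup>L ?Q f = rQ - qQ"
    using int[OF fin(2)] by (auto elim!: integrableE)
  moreover obtain rM qM where "0 \<le> rM" "0 \<le> qM" "(\<integral>\<^sup>+x. ennreal (f x) \<partial>M) = ennreal rM"
    "(\<integral>\<^sup>+x. ennreal (- f x) \<partial>M) = ennreal qM" "integral\<^sup>L M f = rM - qM"
    using int[OF M] by (auto elim!: integrableE)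
  moreover obtain rN qN where "0 \<le> rN" "0 \<le> qN" "(\<integral>\<^sup>+x. ennreal (f x) \<partial>N) = ennreal rN"
    "(\<integral>\<^sup>+x. ennreal (- f x) \<partial>N) = ennreal qN" "integral\<^sup>L N f = rN - qN"
    using int[OF N] by (auto elim!: integrableE)
  ultimately have "rP + rN = rQ + rM" "qP + qN = qQ + qM"
    by (auto simp flip: ennreal_plus)
  then show ?thesis
    unfolding signed_integral_def
    using \<open>integral\<^sup>L ?P f = _\<close> \<open>integral\<^sup>L ?Q f = _\<close> \<open>integral\<^sup>L M f = _\<close> \<open>integral\<^sup>L N f = _\<close> by simp
qed

section \<open>The torus and the discrepancy\<close>

lemma torus_proj_eq_iff: "torus_proj x = torus_proj y \<longleftrightarrow> (\<forall>i. x $ i - y $ i \<in> \<int>)"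
  by transfer simp

lemma torus_proj_diff: "torus_proj (x - y) = torus_proj x - torus_proj y"
  by transfer simp

lemma torus_proj_surj: obtains y where "torus_proj y = x"
proof -
  have "\<exists>y. torus_proj y = x"
    by (induction x rule: torus.abs_induct) (auto simp: torus_proj.abs_eq)
  then show thesis using that by blast
qed

lemma torus_proj_unit_cube: obtains y where "torus_proj y = x" "\<And>i. 0 \<le> y $ i" "\<And>i. y $ i < 1"
proof -
  obtain z where z: "torus_proj z = x" by (rule torus_proj_surj)
  show thesis
  proof (rule that[of "\<chi> i. frac (z $ i)"])
    show "torus_proj (\<chi> i. frac (z $ i)) = x"
      unfolding z[symmetric] torus_proj_eq_iff by (simp add: frac_def)
  qed (auto simp: frac_lt_1)
qed

lemma continuous_on_torus_proj: "continuous_on UNIV torus_proj"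
  by (auto simp: continuous_on_open_vimage open_torus_def)

lemma continuous_on_torusI:
  assumes "continuous_on UNIV (\<lambda>x. f (torus_proj x))"
  shows "continuous_on UNIV f"
proof -
  have "open (f -` U)" if "open U" for U
  proof -
    have "torus_proj -` (f -` U) = (\<lambda>x. f (torus_proj x)) -` U" by auto
    then show ?thesis
      using assms that by (auto simp: continuous_on_open_vimage open_torus_def)
  qed
  then show ?thesis by (auto simp: continuous_on_open_vimage)
qed

lemma continuous_on_compose_torus_proj:
  "continuous_on UNIV f \<Longrightarrow> continuous_on UNIV (\<lambda>x. f (torus_proj x))"
  using continuous_on_compose2[of UNIV f UNIV torus_proj] continuous_on_torus_proj by auto

text \<open>Every class meets the unit cube, so compactness of the cube in \<open>real ^ 'd\<close>
  does the work of compactness of the torus.\<close>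

lemma continuous_on_torus_bounded:
  fixes h :: "('d::finite) torus \<Rightarrow> real"
  assumes "continuous_on UNIV h"
  obtains C where "\<And>x. \<bar>h x\<bar> \<le> C"
proof -
  have "compact ((\<lambda>x. h (torus_proj x)) ` cbox 0 1)"
    by (intro compact_continuous_image continuous_on_subset[OF continuous_on_compose_torus_proj[OF assms]]) auto
  then obtain C where C: "\<And>y. y \<in> cbox 0 1 \<Longrightarrow> \<bar>h (torus_proj y)\<bar> \<le> C"
    using compact_imp_bounded by (force simp: bounded_iff)
  show thesis
  proof (rule that[of C])
    fix x :: "'d torus"
    obtain y where "torus_proj y = x" "\<And>i. 0 \<le> y $ i" "\<And>i. y $ i < 1"
      by (rule torus_proj_unit_cube) blast
    moreover from this have "y \<in> cbox 0 1" by (auto simp: mem_box_cart less_imp_le)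
    ultimately show "\<bar>h x\<bar> \<le> C" using C by blast
  qed
qed

lemma continuous_on_torus_translate:
  fixes h :: "('d::finite) torus \<Rightarrow> 'a::topological_space"
  assumes "continuous_on UNIV h"
  shows "continuous_on UNIV (\<lambda>y. h (x - y))" "continuous_on UNIV (\<lambda>y. h (y - x))"
proof -
  obtain z where z: "x = torus_proj z" by (metis torus_proj_surj)
  have "continuous_on UNIV (\<lambda>y. h (torus_proj (z - y)))" "continuous_on UNIV (\<lambda>y. h (torus_proj (y - z)))"
    by (auto intro!: continuous_on_compose2[OF continuous_on_compose_torus_proj[OF assms]] continuous_intros)
  then show "continuous_on UNIV (\<lambda>y. h (x - y))" "continuous_on UNIV (\<lambda>y. h (y - x))"
    by (auto intro!: continuous_on_torusI simp: z torus_proj_diff)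
qed

lemma finite_measure_torus_lebesgue: "finite_measure (torus_lebesgue :: ('d::finite) torus measure)"
proof -
  let ?Q = "{x :: real ^ 'd. \<forall>i. 0 \<le> x $ i \<and> x $ i < 1}"
  have meas: "?Q \<in> sets borel" by measurable
  have "emeasure lborel ?Q \<le> emeasure lborel (cbox 0 (1 :: real ^ 'd))"
    by (intro emeasure_mono) (auto simp: mem_box_cart less_imp_le)
  also have "\<dots> < \<infinity>" using emeasure_lborel_cbox_finite by simp
  finally have "finite_measure (restrict_space lborel ?Q)"
    using meas by (intro finite_measureI) (auto simp: emeasure_restrict_space space_restrict_space)
  moreover have "torus_proj \<in> borel_measurable (restrict_space lborel ?Q)"
    using borel_measurable_continuous_onI[OF continuous_on_torus_proj]
    by (intro measurable_restrict_space1) auto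
  ultimately show ?thesis
    unfolding torus_lebesgue_def by (intro finite_measure.finite_measure_distr)
qed

lemma sets_torus_lebesgue [simp, measurable_cong]: "sets torus_lebesgue = sets borel"
  by (simp add: torus_lebesgue_def)

section \<open>Continuity of the discrepancy along pointwise convergent maps\<close>

lemma (in finite_measure) tendsto_integral_bounded:
  fixes u :: "nat \<Rightarrow> 'a \<Rightarrow> real"
  assumes "\<And>n. u n \<in> borel_measurable M" "v \<in> borel_measurable M"
    and "\<And>n x. x \<in> space M \<Longrightarrow> \<bar>u n x\<bar> \<le> C" and "\<And>x. x \<in> space M \<Longrightarrow> (\<lambda>n. u n x) \<longlonglongrightarrow> v x"
  shows "(\<lambda>n. \<integral>x. u n x \<partial>M) \<longlonglongrightarrow> (\<integral>x. v x \<partial>M)"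
  using assms by (intro integral_dominated_convergence[where w="\<lambda>_. C"]) auto

lemma (in prob_space) abs_integral_le_bound:
  fixes f :: "'a \<Rightarrow> real"
  assumes "f \<in> borel_measurable M" "\<And>x. \<bar>f x\<bar> \<le> C"
  shows "\<bar>\<integral>x. f x \<partial>M\<bar> \<le> C"
proof -
  have "integrable M f" using assms by (intro integrable_const_bound[of _ C]) auto
  then have "\<bar>\<integral>x. f x \<partial>M\<bar> \<le> (\<integral>x. C \<partial>M)"
    using assms by (intro order_trans[OF integral_abs_bound] integral_mono) auto
  then show ?thesis by (simp add: prob_space)
qed

lemma torus_conv_diff_measure:
  assumes h: "continuous_on UNIV h"
    and "finite_measure M" "sets M = sets borel" "finite_measure N" "sets N = sets borel"
  shows "(h \<star> (measure M - measure N)) x = (\<integral>y. h (x - y) \<partial>M) - (\<integral>y. h (x - y) \<partial>N)"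
proof -
  obtain C where "\<And>x. \<bar>h x\<bar> \<le> C" using continuous_on_torus_bounded[OF h] by blast
  then show ?thesis
    unfolding torus_conv_def using assms
    by (intro signed_integral_diff_measure)
      (auto intro!: borel_measurable_continuous_onI continuous_on_torus_translate)
qed

text \<open>Supplies measurability in \<open>x\<close> of the convolution. The argument is lifted to
  \<open>real ^ 'd\<close>, where continuity may be tested on sequences and dominated convergence
  applies.\<close>

lemma continuous_on_integral_translate:
  fixes h :: "('d::finite) torus \<Rightarrow> real"
  assumes h: "continuous_on UNIV h" and "finite_measure M" and M: "sets M = sets borel"
  shows "continuous_on UNIV (\<lambda>x. \<integral>y. h (x - y) \<partial>M)"
proof (rule continuous_on_torusI, rule continuous_on_sequentiallyI)
  interpret finite_measure M by fact
  obtain C where C: "\<And>x. \<bar>h x\<bar> \<le> C" using continuous_on_torus_bounded[OF h] by blast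
  fix u :: "nat \<Rightarrow> real ^ 'd" and a assume u: "u \<longlonglongrightarrow> a"
  have meas: "(\<lambda>y. h (x - y)) \<in> borel_measurable M" for x
    using borel_measurable_continuous_onI[OF continuous_on_torus_translate(1)[OF h]] M
    by (simp cong: measurable_cong_sets)
  show "(\<lambda>n. \<integral>y. h (torus_proj (u n) - y) \<partial>M) \<longlonglongrightarrow> (\<integral>y. h (torus_proj a - y) \<partial>M)"
  proof (rule tendsto_integral_bounded)
    show "(\<lambda>n. h (torus_proj (u n) - y)) \<longlonglongrightarrow> h (torus_proj a - y)" for y
      by (rule continuous_on_tendsto_compose[OF continuous_on_compose_torus_proj[OF continuous_on_torus_translate(2)[OF h]] u]) auto
  qed (use C meas in auto)
qed

text \<open>Dominated convergence twice: in \<open>t\<close> for fixed \<open>x\<close>, giving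
  pointwise convergence of the convolutions, and then in \<open>x\<close> for their squares.
  Convergence of \<open>p n\<close> enters only through translates of \<open>h\<close>, so no metric
  on the torus is involved.\<close>

proposition conv_norm_tendsto:
  fixes h :: "('d::finite) torus \<Rightarrow> real"
  assumes h: "continuous_on UNIV h" and M: "prob_space M" and N: "prob_space N" "sets N = sets borel"
    and p: "\<And>n. p n \<in> borel_measurable M" "p' \<in> borel_measurable M"
    and lim: "\<And>x t. t \<in> space M \<Longrightarrow> (\<lambda>n. h (x - p n t)) \<longlonglongrightarrow> h (x - p' t)"
  shows "(\<lambda>n. conv_norm h (measure (distr M borel (p n)) - measure N))
    \<longlonglongrightarrow> conv_norm h (measure (distr M borel p') - measure N)"
proof -
  interpret M: prob_space M by fact
  interpret N: prob_space N by fact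
  interpret L: finite_measure "torus_lebesgue :: 'd torus measure" by (rule finite_measure_torus_lebesgue)
  obtain C where C: "\<And>x. \<bar>h x\<bar> \<le> C" using continuous_on_torus_bounded[OF h] by blast
  have meas: "(\<lambda>y. h (x - y)) \<in> borel_measurable borel" for x
    by (rule borel_measurable_continuous_onI[OF continuous_on_torus_translate(1)[OF h]])
  have measM: "(\<lambda>t. h (x - q t)) \<in> borel_measurable M" if "q \<in> borel_measurable M" for x q
    using measurable_compose[OF that meas] .
  have prob: "prob_space (distr M borel q)" if "q \<in> borel_measurable M" for q :: "_ \<Rightarrow> 'd torus"
    using that by (rule M.prob_space_distr)
  have conv: "(h \<star> (measure (distr M borel q) - measure N)) x = (\<integral>t. h (x - q t) \<partial>M) - (\<integral>y. h (x - y) \<partial>N)"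
    if "q \<in> borel_measurable M" for q x
    using torus_conv_diff_measure[OF h, of "distr M borel q" N x] N.finite_measure_axioms N(2)
      prob_space.finite_measure[OF prob[OF that]] integral_distr[OF that meas] by simp
  have cmeas: "(h \<star> (measure (distr M borel q) - measure N)) \<in> borel_measurable borel"
    if "q \<in> borel_measurable M" for q
  proof -
    have "(h \<star> (measure (distr M borel q) - measure N)) = (\<lambda>x. (\<integral>y. h (x - y) \<partial>distr M borel q) - (\<integral>y. h (x - y) \<partial>N))"
      using torus_conv_diff_measure[OF h, of "distr M borel q" N] N.finite_measure_axioms N(2)
        prob_space.finite_measure[OF prob[OF that]] by auto
    also have "\<dots> \<in> borel_measurable borel"
      using N.finite_measure_axioms N(2) prob_space.finite_measure[OF prob[OF that]]
      by (intro borel_measurable_diff borel_measurable_continuous_onI continuous_on_integral_translate[OF h]) auto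
    finally show ?thesis .
  qed
  \<comment> \<open>Both measures are probabilities, so each of the two integrals is at most
    \<open>C\<close> in absolute value. Its square is the constant dominating the outer
    integral.\<close>
  have bound: "\<bar>(h \<star> (measure (distr M borel q) - measure N)) x\<bar> \<le> 2 * C" if "q \<in> borel_measurable M" for q x
    using M.abs_integral_le_bound[OF measM[OF that], of x C] N.abs_integral_le_bound[of "\<lambda>y. h (x - y)" C] meas C N(2)
    by (simp add: conv[OF that] cong: measurable_cong_sets)
  have "(\<lambda>n. (h \<star> (measure (distr M borel (p n)) - measure N)) x) \<longlonglongrightarrow> (h \<star> (measure (distr M borel p') - measure N)) x" for x
    unfolding conv[OF p(1)] conv[OF p(2)]
    using p C lim measM by (intro tendsto_diff tendsto_const M.tendsto_integral_bounded[where C=C]) auto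
  then have "(\<lambda>n. \<integral>x. ((h \<star> (measure (distr M borel (p n)) - measure N)) x)\<^sup>2 \<partial>torus_lebesgue)
      \<longlonglongrightarrow> (\<integral>x. ((h \<star> (measure (distr M borel p') - measure N)) x)\<^sup>2 \<partial>torus_lebesgue)"
    using cmeas[OF p(1)] cmeas[OF p(2)] power_mono[OF bound[OF p(1)] abs_ge_zero, of _ _ 2]
    by (intro L.tendsto_integral_bounded[where C="(2 * C)\<^sup>2"] tendsto_power) auto
  then show ?thesis
    unfolding conv_norm_def L2_norm_def by (rule tendsto_real_sqrt)
qed

section \<open>Smooth plateaus and weakly differentiable functions\<close>

text \<open>The recursion peels off the first derivative, whereas \<open>deriv ^^ k\<close> adds
  derivatives at the outside. In this form closure under sums, products and inverses follows by
  induction with the function generalized.\<close>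

primrec times_differentiable :: "nat \<Rightarrow> (real \<Rightarrow> real) \<Rightarrow> bool" where
  "times_differentiable 0 f \<longleftrightarrow> True"
| "times_differentiable (Suc k) f \<longleftrightarrow> f differentiable_on UNIV \<and> times_differentiable k (deriv f)"

lemma times_differentiable_funpow:
  "times_differentiable (Suc k) f \<Longrightarrow> (deriv ^^ k) f differentiable_on UNIV"
  by (induction k arbitrary: f) (auto simp: funpow_swap1)

lemma differentiable_on_UNIV_real_iff:
  fixes f :: "real \<Rightarrow> real"
  shows "f differentiable_on UNIV \<longleftrightarrow> (\<forall>x. (f has_real_derivative deriv f x) (at x))"
  by (auto simp: differentiable_on_def DERIV_deriv_iff_real_differentiable)

lemma times_differentiable_SucI:
  assumes "\<And>x. (f has_real_derivative f' x) (at x)" "times_differentiable k f'"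
  shows "times_differentiable (Suc k) f"
proof -
  have "deriv f = f'" using assms(1) by (auto intro!: DERIV_imp_deriv)
  then show ?thesis using assms by (auto simp: differentiable_on_UNIV_real_iff)
qed

lemma times_differentiable_Suc_iff:
  "times_differentiable (Suc k) f \<longleftrightarrow>
    (\<forall>x. (f has_real_derivative deriv f x) (at x)) \<and> times_differentiable k (deriv f)"
  by (simp add: differentiable_on_UNIV_real_iff)

lemma times_differentiable_SucD: "times_differentiable (Suc k) f \<Longrightarrow> times_differentiable k f"
  by (induction k arbitrary: f) auto

lemma times_differentiable_const: "times_differentiable k (\<lambda>_. c)"
  by (induction k arbitrary: c) (auto simp: differentiable_on_UNIV_real_iff)

lemma times_differentiable_add:
  "times_differentiable k f \<Longrightarrow> times_differentiable k g \<Longrightarrow> times_differentiable k (\<lambda>x. f x + g x)"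
proof (induction k arbitrary: f g)
  case (Suc k)
  from Suc.prems show ?case
    unfolding times_differentiable_Suc_iff[of k f] times_differentiable_Suc_iff[of k g]
    by (intro times_differentiable_SucI[where f'="\<lambda>x. deriv f x + deriv g x"])
      (auto intro!: derivative_eq_intros Suc.IH)
qed simp

lemma times_differentiable_mult:
  "times_differentiable k f \<Longrightarrow> times_differentiable k g \<Longrightarrow> times_differentiable k (\<lambda>x. f x * g x)"
proof (induction k arbitrary: f g)
  case (Suc k)
  from Suc.prems show ?case
    using times_differentiable_SucD[OF Suc.prems(1)] times_differentiable_SucD[OF Suc.prems(2)]
    unfolding times_differentiable_Suc_iff[of k f] times_differentiable_Suc_iff[of k g]
    by (intro times_differentiable_SucI[where f'="\<lambda>x. deriv f x * g x + deriv g x * f x"])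
      (auto intro!: derivative_eq_intros Suc.IH times_differentiable_add)
qed simp

lemma times_differentiable_diff:
  assumes "times_differentiable k f" "times_differentiable k g"
  shows "times_differentiable k (\<lambda>x. f x - g x)"
  using times_differentiable_add[OF assms(1) times_differentiable_mult[OF times_differentiable_const[of k "-1"] assms(2)]]
  by simp

lemma times_differentiable_inverse:
  "times_differentiable k f \<Longrightarrow> (\<And>x. f x \<noteq> 0) \<Longrightarrow> times_differentiable k (\<lambda>x. inverse (f x))"
proof (induction k)
  case (Suc k)
  have inv: "times_differentiable k (\<lambda>x. inverse (f x))"
    using Suc times_differentiable_SucD by blast
  show ?case
  proof (rule times_differentiable_SucI)
    show "((\<lambda>x. inverse (f x)) has_real_derivative - 1 * (deriv f x * (inverse (f x) * inverse (f x)))) (at x)" for x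
      using Suc.prems unfolding times_differentiable_Suc_iff
      by (auto intro!: derivative_eq_intros)
    show "times_differentiable k (\<lambda>x. - 1 * (deriv f x * (inverse (f x) * inverse (f x))))"
      using Suc.prems inv by (intro times_differentiable_mult times_differentiable_const) auto
  qed
qed simp

lemma has_real_derivative_affine:
  fixes f :: "real \<Rightarrow> real"
  assumes "(f has_real_derivative D) (at (a * x + b))"
  shows "((\<lambda>x. f (a * x + b)) has_real_derivative D * a) (at x)"
  by (rule DERIV_chain2[where g="\<lambda>x. a * x + b", OF assms]) (auto intro!: derivative_eq_intros)

lemma times_differentiable_affine:
  "times_differentiable k f \<Longrightarrow> times_differentiable k (\<lambda>x. f (a * x + b))"
proof (induction k arbitrary: f)
  case (Suc k)
  show ?case
  proof (rule times_differentiable_SucI)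
    show "((\<lambda>x. f (a * x + b)) has_real_derivative deriv f (a * x + b) * a) (at x)" for x
      using Suc.prems unfolding times_differentiable_Suc_iff by (intro has_real_derivative_affine) auto
    show "times_differentiable k (\<lambda>x. deriv f (a * x + b) * a)"
      using Suc.prems by (intro times_differentiable_mult times_differentiable_const Suc.IH) auto
  qed
qed simp

text \<open>The classical flat function exp(-1/x), with a polynomial factor in 1/x so that the
  family is closed under differentiation and a single induction gives smoothness.\<close>

definition flat_exp :: "real poly \<Rightarrow> real \<Rightarrow> real"
  where "flat_exp p x = (if x > 0 then poly p (1 / x) * exp (- (1 / x)) else 0)"

lemma poly_times_exp_minus_tendsto_0: "((\<lambda>x. poly p x * exp (- x)) \<longlongrightarrow> (0::real)) at_top"
proof -
  have "((\<lambda>x. \<Sum>i\<le>degree p. coeff p i * (x ^ i / exp x)) \<longlongrightarrow> (\<Sum>i\<le>degree p. coeff p i * 0)) at_top"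
    by (intro tendsto_sum tendsto_mult tendsto_const tendsto_power_div_exp_0)
  then show ?thesis
    by (simp add: poly_altdef exp_minus divide_inverse sum_distrib_right mult.assoc)
qed

text \<open>With y = 1/x, the derivative of p(y) exp(-y) in y is (p' - p)(y) exp(-y), and dy/dx = -
  y^2; this produces the polynomial \<open>monom 1 2 * (p - pderiv p)\<close>.\<close>

lemma has_real_derivative_flat_exp:
  "(flat_exp p has_real_derivative flat_exp (monom 1 2 * (p - pderiv p)) x) (at x)"
proof (cases x "0 :: real" rule: linorder_cases)
  case less
  have "((\<lambda>_. 0) has_real_derivative flat_exp (monom 1 2 * (p - pderiv p)) x) (at x)"
    using less by (simp add: flat_exp_def)
  then show ?thesis
    by (rule has_field_derivative_transform_within_open[where S="{..<0}"]) (use less in \<open>auto simp: flat_exp_def\<close>)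
next
  case equal
  \<comment> \<open>The right difference quotient at 0 is y p(y) exp(-y) with y = 1/h tending to
    infinity; \<open>pCons 0 p\<close> is the polynomial p multiplied by its variable.\<close>
  have "((\<lambda>x. poly (pCons 0 p) (inverse x) * exp (- inverse x)) \<longlongrightarrow> 0) (at_right 0)"
    by (rule filterlim_compose[OF poly_times_exp_minus_tendsto_0 filterlim_inverse_at_top_right])
  then have "((\<lambda>h. (flat_exp p (0 + h) - flat_exp p 0) / h) \<longlongrightarrow> 0) (at_right 0)"
    by (rule filterlim_cong[THEN iffD1, OF refl refl, rotated])
      (auto simp: flat_exp_def eventually_at_filter field_simps)
  moreover have "((\<lambda>h. (flat_exp p (0 + h) - flat_exp p 0) / h) \<longlongrightarrow> 0) (at_left 0)"
    by (rule tendsto_eventually) (auto simp: flat_exp_def eventually_at_filter)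
  ultimately have "((\<lambda>h. (flat_exp p (0 + h) - flat_exp p 0) / h) \<longlongrightarrow> 0) (at 0)"
    by (simp add: filterlim_split_at)
  then show ?thesis
    using equal by (simp add: has_field_derivative_iff flat_exp_def)
next
  case greater
  have "((\<lambda>x. poly p (1 / x) * exp (- (1 / x))) has_real_derivative flat_exp (monom 1 2 * (p - pderiv p)) x) (at x)"
    using greater
    by (auto intro!: derivative_eq_intros simp: flat_exp_def poly_monom field_simps power2_eq_square)
  then show ?thesis
    by (rule has_field_derivative_transform_within_open[where S="{0<..}"]) (use greater in \<open>auto simp: flat_exp_def\<close>)
qed

lemma times_differentiable_flat_exp: "times_differentiable k (flat_exp p)"
proof (induction k arbitrary: p)
  case (Suc k)
  show ?case
    using has_real_derivative_flat_exp Suc by (rule times_differentiable_SucI)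
qed simp

text \<open>The standard smooth transition u(x) / (u(x) + u(1 - x)) from 0 on the negatives to 1
  beyond 1. The spelling \<open>(- 1) * x + 1\<close> fits the affine substitution lemma.\<close>

definition smooth_step :: "real \<Rightarrow> real"
  where "smooth_step x = flat_exp 1 x * inverse (flat_exp 1 x + flat_exp 1 ((- 1) * x + 1))"

lemma flat_exp_1_nonneg: "0 \<le> flat_exp 1 x"
  by (simp add: flat_exp_def)

lemma flat_exp_1_mono: "x \<le> y \<Longrightarrow> flat_exp 1 x \<le> flat_exp 1 y"
  by (simp add: flat_exp_def frac_le)

lemma flat_exp_1_add_pos: "0 < flat_exp 1 x + flat_exp 1 ((- 1) * x + 1)"
proof (cases "x > 0")
  case True
  then have "0 < flat_exp 1 x" by (simp add: flat_exp_def)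
  then show ?thesis using flat_exp_1_nonneg by (rule add_pos_nonneg)
next
  case False
  then have "0 < flat_exp 1 ((- 1) * x + 1)" by (simp add: flat_exp_def)
  then show ?thesis using flat_exp_1_nonneg by (intro add_nonneg_pos)
qed

lemma times_differentiable_smooth_step: "times_differentiable k smooth_step"
  unfolding smooth_step_def
  by (intro times_differentiable_mult times_differentiable_inverse times_differentiable_add
      times_differentiable_flat_exp times_differentiable_affine[where f="flat_exp 1"] less_imp_neq[OF flat_exp_1_add_pos, symmetric])

lemma smooth_step_eq_0: "x \<le> 0 \<Longrightarrow> smooth_step x = 0"
  by (simp add: smooth_step_def flat_exp_def)

lemma smooth_step_eq_1: "x \<ge> 1 \<Longrightarrow> smooth_step x = 1"
  using flat_exp_1_add_pos[of x] by (simp add: smooth_step_def flat_exp_def)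

text \<open>Needed so that the derivative is nonnegative and can act as an averaging kernel.\<close>

lemma smooth_step_mono: assumes "x \<le> y" shows "smooth_step x \<le> smooth_step y"
proof -
  let ?u = "flat_exp 1"
  \<comment> \<open>What remains of the claim after cross-multiplying by the positive denominators
    and cancelling u(x) u(y).\<close>
  have "?u x * ?u ((- 1) * y + 1) \<le> ?u y * ?u ((- 1) * x + 1)"
    using assms by (intro mult_mono flat_exp_1_mono flat_exp_1_nonneg) auto
  then show ?thesis
    using flat_exp_1_add_pos[of x] flat_exp_1_add_pos[of y]
    by (simp add: smooth_step_def field_simps)
qed

lemma smooth_step_bounds: "0 \<le> smooth_step x" "smooth_step x \<le> 1"
proof -
  show "0 \<le> smooth_step x"
    using smooth_step_mono[of "min 0 x" x] by (simp add: smooth_step_eq_0)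
  show "smooth_step x \<le> 1"
    using smooth_step_mono[of x "max 1 x"] by (simp add: smooth_step_eq_1)
qed

lemma has_real_derivative_smooth_step: "(smooth_step has_real_derivative deriv smooth_step x) (at x)"
  using times_differentiable_smooth_step[of 1] by (simp add: differentiable_on_UNIV_real_iff)

lemma continuous_on_deriv_smooth_step: "continuous_on A (deriv smooth_step)"
proof -
  have "deriv smooth_step differentiable_on UNIV"
    using times_differentiable_smooth_step[of 2] by (simp add: numeral_2_eq_2)
  then show ?thesis
    using differentiable_imp_continuous_on continuous_on_subset by blast
qed

lemma deriv_smooth_step_nonneg: "0 \<le> deriv smooth_step x"
  by (rule mono_on_imp_deriv_nonneg[OF _ has_real_derivative_smooth_step, of UNIV])
    (auto intro!: mono_onI smooth_step_mono)

lemma deriv_smooth_step_eq_0: assumes "x < 0 \<or> 1 < x" shows "deriv smooth_step x = 0"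
proof -
  have "(smooth_step has_real_derivative 0) (at x)"
    using assms
  proof
    assume "x < 0"
    then show ?thesis
      using has_field_derivative_transform_within_open[of "\<lambda>_. 0" 0 x "{..<0}" smooth_step]
      by (simp add: smooth_step_eq_0)
  next
    assume "1 < x"
    then show ?thesis
      using has_field_derivative_transform_within_open[of "\<lambda>_. 1" 0 x "{1<..}" smooth_step]
      by (simp add: smooth_step_eq_1)
  qed
  then show ?thesis by (rule DERIV_imp_deriv)
qed

section \<open>Plateau test functions and the Lipschitz bound\<close>

lemma affine_rescale: "(t - x) / e = inverse e * t + - (x / e)" for t x e :: real
  by (simp add: divide_inverse algebra_simps)

lemma has_real_derivative_smooth_step_rescaled:
  "((\<lambda>t. smooth_step ((t - x) / e)) has_real_derivative deriv smooth_step ((t - x) / e) / e) (at t)"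
  using has_real_derivative_affine[OF has_real_derivative_smooth_step, where a="inverse e" and x=t and b="- (x / e)"]
  unfolding affine_rescale by (simp only: divide_inverse)

text \<open>The function can rise only on \<open>[x, x + e]\<close> and fall only on
  \<open>[y, y + e]\<close>. Its derivative is a difference of two kernels located at
  \<open>x\<close> and \<open>y\<close>, so integrating \<open>f\<close> against it compares
  averages of \<open>f\<close> near these points.\<close>

lemma test_function_plateau:
  assumes "0 < x" "x \<le> y" "0 < e" "y + e < T"
  shows "test_function T (\<lambda>t. smooth_step ((t - x) / e) - smooth_step ((t - y) / e))"
proof -
  let ?\<phi> = "\<lambda>t. smooth_step ((t - x) / e) - smooth_step ((t - y) / e)"
  have "times_differentiable k ?\<phi>" for k
    unfolding affine_rescale
    by (intro times_differentiable_diff times_differentiable_affine[where f=smooth_step] times_differentiable_smooth_step)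
  then have "\<forall>k. (deriv ^^ k) ?\<phi> differentiable_on UNIV"
    by (blast intro: times_differentiable_funpow)
  moreover have zero: "?\<phi> t = 0" if "t \<notin> {x..y + e}" for t
    using that assms by (auto simp: smooth_step_eq_0 smooth_step_eq_1 not_le field_simps divide_nonpos_pos)
  then have sub: "{t. ?\<phi> t \<noteq> 0} \<subseteq> {x..y + e}"
    by blast
  then have "closure {t. ?\<phi> t \<noteq> 0} \<subseteq> {x..y + e}"
    by (intro closure_minimal) auto
  moreover have "compact (closure {t. ?\<phi> t \<noteq> 0})"
    unfolding compact_closure using bounded_closed_interval sub by (rule bounded_subset)
  ultimately show ?thesis
    using assms unfolding test_function_def by auto
qed

text \<open>The kernel is nonnegative, lives on \<open>[z, z + e]\<close> and has total mass 1,
  being the derivative of a rescaled step. The integral is thus a weighted average of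
  \<open>f\<close> over that window.\<close>

lemma mollified_value:
  fixes f :: "real \<Rightarrow> real"
  assumes f: "continuous_on {0..T} f" and z: "0 < z" "0 < e" "z + e \<le> T"
    and d: "\<And>t. t \<in> {z..z + e} \<Longrightarrow> \<bar>f t - f z\<bar> \<le> d"
  shows "\<bar>integral {0..T} (\<lambda>t. f t * (deriv smooth_step ((t - z) / e) / e)) - f z\<bar> \<le> d"
proof -
  define \<eta> where "\<eta> t = deriv smooth_step ((t - z) / e) / e" for t
  have cont: "continuous_on {0..T} \<eta>"
    unfolding \<eta>_def using z by (intro continuous_intros continuous_on_compose2[OF continuous_on_deriv_smooth_step[of UNIV]]) auto
  have "(\<eta> has_integral (smooth_step ((T - z) / e) - smooth_step ((0 - z) / e))) {0..T}"
    unfolding \<eta>_def using z has_real_derivative_smooth_step_rescaled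
    by (intro fundamental_theorem_of_calculus)
      (auto simp flip: has_real_derivative_iff_has_vector_derivative intro: DERIV_subset)
  moreover have "smooth_step ((T - z) / e) = 1" "smooth_step ((0 - z) / e) = 0"
    using z by (auto intro!: smooth_step_eq_0 smooth_step_eq_1 simp: field_simps)
  ultimately have int: "(\<eta> has_integral 1) {0..T}" by simp
  have "integral {0..T} (\<lambda>t. f t * \<eta> t) - f z = integral {0..T} (\<lambda>t. f t * \<eta> t) - integral {0..T} (\<lambda>t. f z * \<eta> t)"
    using has_integral_mult_right[OF int, of "f z"] by (simp only: integral_unique mult_1_right)
  also have "\<dots> = integral {0..T} (\<lambda>t. (f t - f z) * \<eta> t)"
    using f cont by (subst integral_diff[symmetric])
      (auto intro!: integrable_continuous_interval continuous_intros simp: left_diff_distrib)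
  also have "norm \<dots> \<le> integral {0..T} (\<lambda>t. d * \<eta> t)"
  proof (rule integral_norm_bound_integral)
    show "norm ((f t - f z) * \<eta> t) \<le> d * \<eta> t" for t
    proof (cases "t \<in> {z..z + e}")
      case True
      then show ?thesis
        using mult_right_mono[OF d[OF True], of "\<eta> t"] z deriv_smooth_step_nonneg
        by (simp add: abs_mult \<eta>_def)
    next
      case False
      then have "deriv smooth_step ((t - z) / e) = 0"
        using z by (intro deriv_smooth_step_eq_0) (auto simp: field_simps)
      then show ?thesis by (simp add: \<eta>_def)
    qed
  qed (use f cont in \<open>auto intro!: integrable_continuous_interval continuous_intros\<close>)
  also have "\<dots> = d"
    using has_integral_mult_right[OF int, of d] by (simp only: integral_unique mult_1_right)
  finally show ?thesis by (simp add: \<eta>_def)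
qed

text \<open>Tested on a plateau, the weak identity equates the difference of two averages of
  \<open>f\<close> with the integral of \<open>g\<close> times a function bounded by 1 on
  \<open>[x, y + e]\<close>. Letting \<open>e\<close> tend to 0 turns averages into values, because
  \<open>f\<close> itself is continuous.\<close>

proposition weak_deriv_imp_lipschitz:
  assumes T: "0 < T" and f: "continuous_on {0..T} f"
    and g: "g \<in> borel_measurable (lebesgue_on {0..T})" "AE t in lebesgue_on {0..T}. \<bar>g t\<bar> \<le> C"
    and weak: "has_weak_deriv T 1 f g"
  shows "C-lipschitz_on {0..T} f"
proof -
  have "0 \<le> C"
  proof (rule ccontr)
    assume "\<not> 0 \<le> C"
    then have "AE t in lebesgue_on {0..T}. False" using g(2) by (auto elim: eventually_mono)
    then show False using T by (simp add: eventually_False ae_filter_eq_bot_iff emeasure_restrict_space space_restrict_space)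
  qed
  \<comment> \<open>The term \<open>2 * d\<close> pays for replacing two averages by values, and
    \<open>C * e\<close> for the part of the support beyond \<open>y\<close>.\<close>
  have approx: "\<bar>f y - f x\<bar> \<le> C * (y + e - x) + 2 * d"
    if xy: "0 < x" "x \<le> y" "0 < e" "y + e < T"
      and d: "\<And>s t. s \<in> {0..T} \<Longrightarrow> t \<in> {0..T} \<Longrightarrow> \<bar>t - s\<bar> \<le> e \<Longrightarrow> \<bar>f t - f s\<bar> \<le> d" for x y e d
  proof -
    let ?\<phi> = "\<lambda>t. smooth_step ((t - x) / e) - smooth_step ((t - y) / e)"
    define \<eta> where "\<eta> z t = deriv smooth_step ((t - z) / e) / e" for z t
    have deriv: "deriv ?\<phi> = (\<lambda>t. \<eta> x t - \<eta> y t)"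
      unfolding \<eta>_def by (intro ext DERIV_imp_deriv DERIV_diff has_real_derivative_smooth_step_rescaled)
    have cont: "continuous_on {0..T} (\<eta> z)" for z
      unfolding \<eta>_def using xy by (intro continuous_intros continuous_on_compose2[OF continuous_on_deriv_smooth_step[of UNIV]]) auto
    have "continuous_on UNIV ?\<phi>"
      using has_real_derivative_smooth_step_rescaled
      by (intro continuous_intros) (meson DERIV_isCont continuous_at_imp_continuous_on)+
    then have \<phi>meas: "?\<phi> \<in> borel_measurable (lebesgue_on {0..T})"
      by (intro continuous_imp_measurable_on_sets_lebesgue) (auto intro: continuous_on_subset)
    have "(\<integral>t. f t * deriv ?\<phi> t \<partial>lebesgue_on {0..T}) = - (\<integral>t. g t * ?\<phi> t \<partial>lebesgue_on {0..T})"
      using weak[unfolded has_weak_deriv_def, rule_format, OF test_function_plateau[OF xy(1-4)]] by simp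
    moreover have "(\<integral>t. f t * deriv ?\<phi> t \<partial>lebesgue_on {0..T}) = integral {0..T} (\<lambda>t. f t * deriv ?\<phi> t)"
      unfolding deriv using f cont
      by (intro lebesgue_integral_eq_integral continuous_imp_integrable_real continuous_intros) auto
    moreover have "\<dots> = integral {0..T} (\<lambda>t. f t * \<eta> x t) - integral {0..T} (\<lambda>t. f t * \<eta> y t)"
      unfolding deriv right_diff_distrib using f cont
      by (intro integral_diff integrable_continuous_interval continuous_intros) auto
    moreover have "\<bar>integral {0..T} (\<lambda>t. f t * \<eta> x t) - f x\<bar> \<le> d"
      unfolding \<eta>_def using xy by (intro mollified_value[OF f]) (auto intro!: d)
    moreover have "\<bar>integral {0..T} (\<lambda>t. f t * \<eta> y t) - f y\<bar> \<le> d"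
      unfolding \<eta>_def using xy by (intro mollified_value[OF f]) (auto intro!: d)
    moreover have "\<bar>\<integral>t. g t * ?\<phi> t \<partial>lebesgue_on {0..T}\<bar> \<le> C * (y + e - x)"
    proof -
      have *: "AE t in lebesgue_on {0..T}. \<bar>g t * ?\<phi> t\<bar> \<le> C * indicator {x..y + e} t"
        using g(2)
      proof (rule eventually_mono)
        fix t assume gt: "\<bar>g t\<bar> \<le> C"
        show "\<bar>g t * ?\<phi> t\<bar> \<le> C * indicator {x..y + e} t"
        proof (cases "t \<in> {x..y + e}")
          case True
          have "\<bar>?\<phi> t\<bar> \<le> 1"
            using smooth_step_bounds[of "(t - x) / e"] smooth_step_bounds[of "(t - y) / e"] by linarith
          then show ?thesis using gt True mult_mono[of "\<bar>g t\<bar>" C "\<bar>?\<phi> t\<bar>" 1] \<open>0 \<le> C\<close> by (simp add: abs_mult)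
        next
          case False
          then have "?\<phi> t = 0"
            using xy by (auto simp: smooth_step_eq_0 smooth_step_eq_1 not_le field_simps divide_nonpos_pos)
          then show ?thesis using \<open>0 \<le> C\<close> by simp
        qed
      qed
      have ind: "integrable (lebesgue_on {0..T}) (\<lambda>t. C * indicator {x..y + e} t)"
        using xy by (intro integrable_mult_right integrable_real_indicator)
          (auto simp: sets_restrict_space_iff emeasure_restrict_space)
      have g\<phi>: "integrable (lebesgue_on {0..T}) (\<lambda>t. g t * ?\<phi> t)"
      proof (rule Bochner_Integration.integrable_bound[OF ind])
        show "AE t in lebesgue_on {0..T}. norm (g t * ?\<phi> t) \<le> norm (C * indicator {x..y + e} t)"
          using * by (rule eventually_mono) (metis abs_ge_self order_trans real_norm_def)
      qed (rule borel_measurable_times[OF g(1) \<phi>meas])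
      have "\<bar>\<integral>t. g t * ?\<phi> t \<partial>lebesgue_on {0..T}\<bar> \<le> (\<integral>t. \<bar>g t * ?\<phi> t\<bar> \<partial>lebesgue_on {0..T})"
        by (rule integral_abs_bound)
      also have "\<dots> \<le> (\<integral>t. C * indicator {x..y + e} t \<partial>lebesgue_on {0..T})"
        using integrable_abs[OF g\<phi>] ind * by (rule integral_mono_AE)
      also have "\<dots> = C * measure (lebesgue_on {0..T}) {x..y + e}"
        using xy by (simp add: Int_absorb2 sets_restrict_space_iff space_restrict_space)
      also have "\<dots> = C * (y + e - x)"
        using xy by (simp add: measure_restrict_space)
      finally show ?thesis .
    qed
    ultimately show ?thesis by linarith
  qed
  have interior: "\<bar>f y - f x\<bar> \<le> C * (y - x)" if xy: "0 < x" "x \<le> y" "y < T" for x y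
  proof (rule field_le_epsilon)
    fix r :: real assume "0 < r"
    then have "0 < r / 4" by simp
    have "uniformly_continuous_on {0..T} f"
      using f by (rule compact_uniformly_continuous) simp
    then obtain e0 where e0: "e0 > 0" "\<And>s t. s \<in> {0..T} \<Longrightarrow> t \<in> {0..T} \<Longrightarrow> \<bar>t - s\<bar> < e0 \<Longrightarrow> \<bar>f t - f s\<bar> < r / 4"
      using \<open>0 < r / 4\<close> unfolding uniformly_continuous_on_def dist_real_def by meson
    \<comment> \<open>The three bounds serve, in order, the modulus of continuity at level
      \<open>r / 4\<close>, keeping the support below \<open>T\<close>, and
      \<open>C * e \<le> r / 2\<close>. Dividing by \<open>C + 1\<close> allows
      \<open>C = 0\<close>. The errors add up to \<open>r\<close>.\<close>
    define e where "e = min (e0 / 2) (min ((T - y) / 2) (r / (2 * (C + 1))))"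
    have "0 < e0 / 2" "0 < (T - y) / 2" "0 < r / (2 * (C + 1))"
      using e0 xy \<open>0 < r\<close> \<open>0 \<le> C\<close> by auto
    then have "0 < e" by (simp add: e_def)
    moreover have "e \<le> e0 / 2" "e \<le> (T - y) / 2" "e \<le> r / (2 * (C + 1))"
      unfolding e_def by linarith+
    ultimately have e: "0 < e" "e < e0" "y + e < T" "e \<le> r / (2 * (C + 1))"
      using xy by auto
    have "\<bar>f y - f x\<bar> \<le> C * (y + e - x) + 2 * (r / 4)"
      using xy e e0(2) by (intro approx) (auto intro!: less_imp_le)
    moreover have "C * e \<le> r / 2"
    proof -
      have *: "c * (r / (2 * c)) = r / 2" if "c \<noteq> 0" for c
        using that by simp
      have "C * e \<le> (C + 1) * (r / (2 * (C + 1)))"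
        using e \<open>0 \<le> C\<close> by (intro mult_mono) auto
      also have "(C + 1) * (r / (2 * (C + 1))) = r / 2"
        using *[of "C + 1"] \<open>0 \<le> C\<close> by simp
      finally show ?thesis .
    qed
    ultimately show "\<bar>f y - f x\<bar> \<le> C * (y - x) + r"
      by (simp add: algebra_simps)
  qed
  \<comment> \<open>Test functions are supported in the open interval, so the endpoints are reached
    only by continuity.\<close>
  have "C-lipschitz_on (closure {0<..<T}) f"
  proof (rule lipschitz_on_closure)
    show "C-lipschitz_on {0<..<T} f"
    proof (rule lipschitz_onI)
      fix x y assume "x \<in> {0<..<T}" "y \<in> {0<..<T}"
      then show "dist (f x) (f y) \<le> C * dist x y"
        using interior[of x y] interior[of y x] by (cases x y rule: le_cases) (auto simp: dist_real_def abs_minus_commute)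
    qed fact
    show "continuous_on (closure {0<..<T}) f" using f T by simp
  qed
  then show ?thesis using T by simp
qed

section \<open>Densities of Lipschitz functions\<close>

text \<open>Adding a linear function turns \<open>f\<close> into a homeomorphism \<open>H\<close> of the line; the image of
  Lebesgue measure under \<open>H\<^sup>-\<^sup>1\<close> is absolutely continuous because Lipschitz maps preserve null sets.\<close>

lemma lipschitz_real_has_density:
  fixes f :: "real \<Rightarrow> real"
  assumes "L-lipschitz_on UNIV f"
  obtains g where "g \<in> borel_measurable borel" "\<And>a b. a \<le> b \<Longrightarrow> (g has_integral f b - f a) {a..b}"
proof -
  have f: "\<bar>f b - f a\<bar> \<le> L * \<bar>b - a\<bar>" for a b
    using lipschitz_onD[OF assms, of b a] by (simp add: dist_real_def)
  have "0 \<le> L" using assms by (rule lipschitz_on_nonneg)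
  \<comment> \<open>The slope \<open>L + 1\<close> outweighs \<open>f\<close>: increments of
    \<open>H\<close> lie between 1 and \<open>2 * L + 1\<close> times those of the argument. The
    lower bound makes the inverse 1-Lipschitz, the upper one keeps null sets null.\<close>
  define H where "H t = (L + 1) * t + f t" for t
  have H_ge: "b - a \<le> H b - H a" and H_le: "H b - H a \<le> (2 * L + 1) * (b - a)" if "a \<le> b" for a b
    using f[of b a] that by (auto simp: H_def algebra_simps abs_le_iff)
  have "continuous_on UNIV f"
    using lipschitz_on_continuous_on[OF assms] .
  then have contH: "continuous_on UNIV H"
    unfolding H_def by (intro continuous_intros)
  have mono: "strict_mono H"
  proof (rule strict_monoI)
    show "H a < H b" if "a < b" for a b
      using H_ge[of a b] that by linarith
  qed
  have "surj H"
    unfolding surj_def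
  proof
    fix y
    define c where "c = \<bar>y - H 0\<bar>"
    have "H (- c) \<le> y" "y \<le> H c"
      using H_ge[of 0 c] H_ge[of "-c" 0] by (auto simp: c_def)
    moreover have "- c \<le> c" by (simp add: c_def)
    ultimately show "\<exists>x. y = H x"
      using IVT'[of H "-c" y c] contH continuous_on_subset by blast
  qed
  moreover have "inj H" using mono by (rule strict_mono_imp_inj_on)
  ultimately have "bij H" by (rule bijI[rotated])
  define K where "K = inv H"
  have HK: "H (K y) = y" and KH: "K (H x) = x" for x y
    using \<open>bij H\<close> by (simp_all add: K_def bij_is_surj surj_f_inv_f bij_is_inj)
  have vimage: "K -` A = H ` A" for A
  proof
    show "K -` A \<subseteq> H ` A" by (metis HK image_eqI subsetI vimageE)
    show "H ` A \<subseteq> K -` A" by (auto simp: KH)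
  qed
  have K_le: "\<bar>K y - K x\<bar> \<le> \<bar>y - x\<bar>" for x y
    using H_ge[of "K x" "K y"] H_ge[of "K y" "K x"] by (cases "K x" "K y" rule: le_cases) (auto simp: HK)
  have "1-lipschitz_on UNIV K"
    by (rule lipschitz_onI) (use K_le in \<open>auto simp: dist_real_def\<close>)
  then have Kmeas: "K \<in> borel_measurable borel"
    by (intro borel_measurable_continuous_onI lipschitz_on_continuous_on)
  define \<nu> where "\<nu> = distr lborel borel K"
  have em: "emeasure \<nu> A = emeasure lborel (H ` A)" if "A \<in> sets borel" for A
    unfolding \<nu>_def using Kmeas that by (subst emeasure_distr) (auto simp: vimage)
  have "absolutely_continuous lborel \<nu>"
    unfolding absolutely_continuous_def
  proof
    fix A :: "real set" assume A: "A \<in> null_sets lborel"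
    then have "A \<in> sets borel" by auto
    then have "H ` A \<in> sets borel"
      using measurable_sets[OF Kmeas] by (simp add: vimage)
    have "negligible A"
      using A by (simp add: negligible_iff_null_sets null_sets_completionI)
    then have "negligible (H ` A)"
    proof (rule negligible_locally_Lipschitz_image[rotated])
      have "\<bar>H y - H x\<bar> \<le> (2 * L + 1) * \<bar>y - x\<bar>" for x y
        using H_le[of x y] H_le[of y x] H_ge[of x y] H_ge[of y x] by (cases x y rule: le_cases) auto
      then show "\<exists>T B. open T \<and> x \<in> T \<and> (\<forall>y\<in>A \<inter> T. norm (H y - H x) \<le> B * norm (y - x))" for x
        by (metis UNIV_I open_UNIV real_norm_def)
    qed simp
    then have "H ` A \<in> null_sets lborel"
      using \<open>H ` A \<in> sets borel\<close> by (simp add: negligible_iff_null_sets null_sets_completion_iff)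
    then show "A \<in> null_sets \<nu>"
      using em \<open>A \<in> sets borel\<close> by (simp add: null_sets_def \<nu>_def)
  qed
  then obtain k where k: "k \<in> borel_measurable lborel" "density lborel k = \<nu>"
    using sigma_finite_measure.Radon_Nikodym[OF sigma_finite_lborel, of \<nu>] by (auto simp: \<nu>_def)
  have int: "((\<lambda>x. enn2real (k x)) has_integral H b - H a) {a..b}" if "a \<le> b" for a b
  proof -
    have "H ` {a..b} = {H a..H b}"
    proof
      show "H ` {a..b} \<subseteq> {H a..H b}" using mono by (auto simp: strict_mono_less_eq)
      show "{H a..H b} \<subseteq> H ` {a..b}"
      proof
        fix y assume "y \<in> {H a..H b}"
        then have "K y \<in> {a..b}"
          using strict_mono_less_eq[OF mono, of a "K y"] strict_mono_less_eq[OF mono, of "K y" b] by (simp add: HK)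
        then show "y \<in> H ` {a..b}" by (metis HK image_eqI)
      qed
    qed
    then have "emeasure \<nu> {a..b} = ennreal (H b - H a)"
      using that H_ge[OF that] by (simp add: em)
    then have nn: "(\<integral>\<^sup>+x. k x * indicator {a..b} x \<partial>lborel) = ennreal (H b - H a)"
      using k by (metis emeasure_density borel_closed closed_real_atLeastAtMost sets_lborel)
    have "AE x in lborel. k x * indicator {a..b} x \<noteq> \<infinity>"
      using k(1) nn by (intro nn_integral_PInf_AE) auto
    then have "(\<integral>\<^sup>+x. ennreal (enn2real (k x) * indicator {a..b} x) \<partial>lborel) = ennreal (H b - H a)"
      unfolding nn[symmetric]
      by (intro nn_integral_cong_AE) (auto elim!: eventually_mono split: split_indicator simp: less_top)
    then have "((\<lambda>x. enn2real (k x) * indicator {a..b} x) has_integral H b - H a) UNIV"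
      using k(1) H_ge[OF that] that by (intro nn_integral_has_integral) auto
    moreover have "(\<lambda>x. enn2real (k x) * indicator {a..b} x) = (\<lambda>x. if x \<in> {a..b} then enn2real (k x) else 0)"
      by (auto split: split_indicator)
    ultimately show ?thesis
      using has_integral_restrict_UNIV[of "{a..b}" "\<lambda>x. enn2real (k x)"] by simp
  qed
  show thesis
  proof (rule that)
    show "(\<lambda>x. enn2real (k x) - (L + 1)) \<in> borel_measurable borel"
      using k(1) by simp
    fix a b :: real assume "a \<le> b"
    have "((\<lambda>x. enn2real (k x) - (L + 1)) has_integral (H b - H a) - (L + 1) * (b - a)) {a..b}"
      using has_integral_diff[OF int[OF \<open>a \<le> b\<close>] has_integral_const_real[of "L + 1" a b]] \<open>a \<le> b\<close>
      by (simp add: mult.commute)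
    then show "((\<lambda>x. enn2real (k x) - (L + 1)) has_integral f b - f a) {a..b}"
      by (simp add: H_def algebra_simps)
  qed
qed

text \<open>Densities exist for each coordinate, but coordinate bounds would not give the Euclidean
  bound \<open>L\<close>. Lebesgue differentiation does: off a negligible set, \<open>g x\<close> is
  a limit of difference quotients of \<open>f\<close>, each of norm at most
  \<open>L\<close>.\<close>

proposition lipschitz_has_bounded_density:
  fixes f :: "real \<Rightarrow> 'a::euclidean_space"
  assumes f: "L-lipschitz_on UNIV f"
  obtains g where "g \<in> borel_measurable lebesgue" "\<And>t. norm (g t) \<le> L"
    "\<And>a b. a \<le> b \<Longrightarrow> (g has_integral f b - f a) {a..b}"
proof -
  have "0 \<le> L" using f by (rule lipschitz_on_nonneg)
  have "\<exists>g. g \<in> borel_measurable borel \<and> (\<forall>a b. a \<le> b \<longrightarrow> (g has_integral f b \<bullet> i - f a \<bullet> i) {a..b})"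
    if "i \<in> Basis" for i
  proof -
    have "L-lipschitz_on UNIV (\<lambda>t. f t \<bullet> i)"
    proof (rule lipschitz_onI)
      show "dist (f x \<bullet> i) (f y \<bullet> i) \<le> L * dist x y" for x y
        using order_trans[OF Basis_le_norm[OF that, of "f x - f y"]] lipschitz_onD[OF f, of x y]
        by (simp add: dist_norm inner_diff_left)
    qed fact
    then show ?thesis by (rule lipschitz_real_has_density) blast
  qed
  then obtain k where k: "\<And>i. i \<in> Basis \<Longrightarrow> k i \<in> borel_measurable borel"
    "\<And>i a b. i \<in> Basis \<Longrightarrow> a \<le> b \<Longrightarrow> (k i has_integral f b \<bullet> i - f a \<bullet> i) {a..b}"
    by metis
  define g where "g t = (\<Sum>i\<in>Basis. k i t *\<^sub>R i)" for t
  have gmeas: "g \<in> borel_measurable borel"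
    unfolding g_def using k(1) by (intro borel_measurable_sum borel_measurable_scaleR) auto
  have int: "(g has_integral f b - f a) {a..b}" if "a \<le> b" for a b
    unfolding has_integral_componentwise_iff[of g]
    using k(2)[OF _ that] by (simp add: g_def inner_diff_left inner_sum_left inner_Basis if_distrib cong: if_cong)
  have "g integrable_on cbox a b" for a b
    using int[of a b] by (cases "a \<le> b") (auto simp: integrable_on_def)
  then obtain N where N: "negligible N" "\<And>x e. x \<notin> N \<Longrightarrow> 0 < e \<Longrightarrow>
      \<exists>d>0. \<forall>h. 0 < h \<and> h < d \<longrightarrow> norm (integral (cbox x (x + h *\<^sub>R One)) g /\<^sub>R h ^ DIM(real) - g x) < e"
    by (rule integrable_ccontinuous_explicit) blast
  have bound: "norm (g x) \<le> L" if xN: "x \<notin> N" for x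
  proof (rule field_le_epsilon)
    fix e :: real assume "0 < e"
    then obtain d where d: "d > 0" "\<And>h. 0 < h \<Longrightarrow> h < d \<Longrightarrow> norm (integral (cbox x (x + h *\<^sub>R One)) g /\<^sub>R h ^ DIM(real) - g x) < e"
      using N(2)[OF xN] by blast
    define h where "h = d / 2"
    have h: "0 < h" "h < d" using d by (auto simp: h_def)
    have eq: "integral {x..x + h} g = f (x + h) - f x"
      using int[of x "x + h"] h by (simp add: integral_unique)
    have "norm (f (x + h) - f x) \<le> L * h"
      using lipschitz_onD[OF f, of "x + h" x] h by (simp add: dist_norm)
    then have "norm ((f (x + h) - f x) /\<^sub>R h) \<le> L"
      using h unfolding norm_scaleR by (simp add: field_simps)
    moreover have "norm ((f (x + h) - f x) /\<^sub>R h - g x) < e"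
      using d(2)[OF h] by (simp add: eq)
    ultimately show "norm (g x) \<le> L + e"
      using norm_triangle_sub[of "g x" "(f (x + h) - f x) /\<^sub>R h"] by (simp add: norm_minus_commute)
  qed
  show thesis
  proof (rule that)
    \<comment> \<open>Truncation on the exceptional set upgrades the almost everywhere bound to one
      valid at every \<open>t\<close> and leaves the integrals unchanged.\<close>
    let ?g = "\<lambda>t. if norm (g t) \<le> L then g t else 0"
    have "?g \<in> borel_measurable borel" using gmeas by measurable
    then show "?g \<in> borel_measurable lebesgue" by (simp add: borel_measurable_if measurable_completion)
    show "norm (?g t) \<le> L" for t using \<open>0 \<le> L\<close> by simp
    show "(?g has_integral f b - f a) {a..b}" if "a \<le> b" for a b
      using bound by (intro has_integral_spike[OF N(1) _ int[OF that]]) auto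
  qed
qed

section \<open>Weak-* compactness\<close>

lemma integrable_lebesgue_on_bounded:
  fixes g :: "real \<Rightarrow> 'b::euclidean_space"
  assumes "g \<in> borel_measurable (lebesgue_on {a..b})" "AE t in lebesgue_on {a..b}. norm (g t) \<le> C"
  shows "integrable (lebesgue_on {a..b}) g"
  using assms finite_measure_lebesgue_on[of "{a..b}"]
  by (intro finite_measure.integrable_const_bound[where B=C]) auto

lemma has_integral_norm_le_interval:
  fixes f :: "real \<Rightarrow> 'b::real_normed_vector"
  assumes "(f has_integral i) {a..b}" "a \<le> b" "0 \<le> B" "\<And>x. x \<in> {a..b} \<Longrightarrow> norm (f x) \<le> B"
  shows "norm i \<le> B * (b - a)"
  using has_integral_bound_real[of B "{}" f i a b] assms by simp

text \<open>Difference quotients at \<open>x\<close> are at most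
  \<open>K * \<bar>y - x\<bar>\<close>, so the derivative is 0 throughout
  \<open>[a, b]\<close>.\<close>

lemma constant_on_if_quadratic_increments:
  fixes D :: "real \<Rightarrow> real"
  assumes "\<And>s t. a \<le> s \<Longrightarrow> s \<le> t \<Longrightarrow> t \<le> b \<Longrightarrow> \<bar>D t - D s\<bar> \<le> K * (t - s)\<^sup>2" and "a \<le> b"
  shows "D b = D a"
proof -
  have D: "\<bar>D t - D s\<bar> \<le> K * (t - s)\<^sup>2" if "s \<in> {a..b}" "t \<in> {a..b}" for s t
    using assms(1)[of s t] assms(1)[of t s] that
    by (cases s t rule: le_cases) (auto simp: abs_minus_commute power2_commute)
  have "(D has_real_derivative 0) (at x within {a..b})" if "x \<in> {a..b}" for x
    unfolding has_field_derivative_iff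
  proof (rule Lim_null_comparison)
    have "norm ((D y - D x) / (y - x)) \<le> K * \<bar>y - x\<bar>" if "y \<in> {a..b}" "y \<noteq> x" for y
    proof -
      have "\<bar>D y - D x\<bar> \<le> K * \<bar>y - x\<bar> * \<bar>y - x\<bar>"
        using D[OF \<open>x \<in> {a..b}\<close> that(1)] by (simp add: power2_eq_square mult.assoc flip: abs_mult)
      then show ?thesis
        using that by (simp add: abs_divide pos_divide_le_eq)
    qed
    then show "\<forall>\<^sub>F y in at x within {a..b}. norm ((D y - D x) / (y - x)) \<le> K * \<bar>y - x\<bar>"
      by (auto simp: eventually_at_filter)
    have "((\<lambda>y. K * \<bar>y - x\<bar>) \<longlongrightarrow> K * \<bar>x - x\<bar>) (at x within {a..b})"
      by (intro tendsto_intros)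
    then show "((\<lambda>y. K * \<bar>y - x\<bar>) \<longlongrightarrow> 0) (at x within {a..b})" by simp
  qed
  then have "\<exists>c. \<forall>x\<in>{a..b}. D x = c"
    by (intro has_field_derivative_zero_constant) auto
  then show ?thesis using \<open>a \<le> b\<close> by auto
qed

text \<open>The defect of the product rule over \<open>[s, t]\<close> is \<open>O((t - s)\<^sup>2)\<close>, so it vanishes; this avoids
  differentiating the Lipschitz function \<open>G\<close> almost everywhere.\<close>

lemma integral_by_parts_bounded_density:
  fixes g G \<phi> \<phi>' :: "real \<Rightarrow> real"
  assumes T: "0 \<le> T"
    and g: "g \<in> borel_measurable (lebesgue_on {0..T})" "\<And>t. \<bar>g t\<bar> \<le> C"
    and G: "\<And>a b. 0 \<le> a \<Longrightarrow> a \<le> b \<Longrightarrow> b \<le> T \<Longrightarrow> (g has_integral G b - G a) {a..b}"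
    and \<phi>: "\<And>t. (\<phi> has_real_derivative \<phi>' t) (at t)" "continuous_on {0..T} \<phi>'" "\<phi> 0 = 0" "\<phi> T = 0"
  shows "(\<integral>t. g t * \<phi> t \<partial>lebesgue_on {0..T}) = - (\<integral>t. G t * \<phi>' t \<partial>lebesgue_on {0..T})"
proof -
  have "0 \<le> C" using g(2)[of 0] by simp
  have contG: "continuous_on {0..T} G"
  proof -
    have lip: "\<bar>G b - G a\<bar> \<le> C * \<bar>b - a\<bar>" if "a \<in> {0..T}" "b \<in> {0..T}" "a \<le> b" for a b
      using has_integral_norm_le_interval[OF G[of a b], of C] g(2) that \<open>0 \<le> C\<close> by simp
    have "C-lipschitz_on {0..T} G"
    proof (rule lipschitz_onI)
      show "dist (G x) (G y) \<le> C * dist x y" if "x \<in> {0..T}" "y \<in> {0..T}" for x y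
        using lip[of x y] lip[of y x] that
        by (cases x y rule: le_cases) (auto simp: dist_real_def abs_minus_commute)
    qed fact
    then show ?thesis by (rule lipschitz_on_continuous_on)
  qed
  have cont\<phi>: "continuous_on UNIV \<phi>"
    using \<phi>(1) by (meson DERIV_isCont continuous_at_imp_continuous_on)
  have "bounded (\<phi>' ` {0..T})" "bounded (\<phi> ` {0..T})"
    using \<phi>(2) cont\<phi> by (auto intro!: compact_imp_bounded compact_continuous_image intro: continuous_on_subset)
  then obtain M0 M1 where M0: "\<And>t. t \<in> {0..T} \<Longrightarrow> \<bar>\<phi>' t\<bar> \<le> M0" and M1: "\<And>t. t \<in> {0..T} \<Longrightarrow> \<bar>\<phi> t\<bar> \<le> M1"
    unfolding bounded_iff by (metis image_eqI real_norm_def)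
  have "0 \<le> M0" using M0[of 0] T by simp
  have cont1: "continuous_on {0..T} (\<lambda>t. G t * \<phi>' t)"
    using contG \<phi>(2) by (intro continuous_intros)
  have int1: "integrable (lebesgue_on {0..T}) (\<lambda>t. G t * \<phi>' t)"
    by (rule continuous_imp_integrable_real[OF cont1])
  have int2: "integrable (lebesgue_on {0..T}) (\<lambda>t. g t * \<phi> t)"
  proof (rule integrable_lebesgue_on_bounded)
    show "(\<lambda>t. g t * \<phi> t) \<in> borel_measurable (lebesgue_on {0..T})"
      using cont\<phi> by (intro borel_measurable_times g(1) continuous_imp_measurable_on_sets_lebesgue)
        (auto intro: continuous_on_subset)
    show "AE t in lebesgue_on {0..T}. norm (g t * \<phi> t) \<le> C * M1"
      using g(2) M1 \<open>0 \<le> C\<close> by (intro AE_I2) (auto simp: space_restrict_space abs_mult intro!: mult_mono)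
  qed
  let ?F = "\<lambda>t. g t * \<phi> t + G t * \<phi>' t"
  have intF: "integrable (lebesgue_on {0..T}) ?F"
    by (intro Bochner_Integration.integrable_add int1 int2)
  then have F: "?F integrable_on {0..T}"
    by (rule integrable_on_lebesgue_on) simp
  \<comment> \<open>The defect of the product rule on \<open>[0, t]\<close>. Since
    \<open>\<phi>\<close> vanishes at both ends, its constancy says that the integral of
    \<open>?F\<close> over \<open>[0, T]\<close> is 0.\<close>
  define D where "D t = G t * \<phi> t - integral {0..t} ?F" for t
  have "D T = D 0"
  proof (rule constant_on_if_quadratic_increments[where D=D and a=0 and b=T])
    fix s t assume st: "0 \<le> s" "s \<le> t" "t \<le> T"
    have "integral {0..t} ?F = integral {0..s} ?F + integral {s..t} ?F"
      using st F by (intro Henstock_Kurzweil_Integration.integral_combine[symmetric] integrable_on_subinterval[OF F]) auto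
    moreover have "(?F has_integral integral {s..t} ?F) {s..t}"
      using st by (intro integrable_integral integrable_on_subinterval[OF F]) auto
    \<comment> \<open>Freezing \<open>\<phi>\<close> at \<open>t\<close> and \<open>G\<close> at
      \<open>s\<close> makes both integrals exact, and their sum telescopes to the increment of the
      product of \<open>G\<close> and \<open>\<phi>\<close>.\<close>
    moreover have "((\<lambda>u. g u * \<phi> t) has_integral (G t - G s) * \<phi> t) {s..t}"
      using st by (intro has_integral_mult_left G) auto
    moreover have "((\<lambda>u. G s * \<phi>' u) has_integral G s * (\<phi> t - \<phi> s)) {s..t}"
      using st \<phi>(1) by (intro has_integral_mult_right fundamental_theorem_of_calculus)
        (auto simp flip: has_real_derivative_iff_has_vector_derivative intro: DERIV_subset)
    ultimately have "((\<lambda>u. g u * \<phi> t + G s * \<phi>' u - ?F u) has_integral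
        (G t - G s) * \<phi> t + G s * (\<phi> t - \<phi> s) - integral {s..t} ?F) {s..t}"
      by (intro has_integral_diff has_integral_add)
    moreover have "(G t - G s) * \<phi> t + G s * (\<phi> t - \<phi> s) - integral {s..t} ?F = D t - D s"
      unfolding D_def \<open>integral {0..t} ?F = _\<close> by (simp add: algebra_simps)
    ultimately have hi: "((\<lambda>u. g u * \<phi> t + G s * \<phi>' u - ?F u) has_integral D t - D s) {s..t}"
      by simp
    \<comment> \<open>The remaining integrand is
      \<open>g u * (\<phi> t - \<phi> u) + (G s - G u) * \<phi>' u\<close>. Each summand contains an
      increment of size O(t - s); the length of the interval supplies the second factor.\<close>
    have hb: "norm (g u * \<phi> t + G s * \<phi>' u - ?F u) \<le> 2 * (C * M0) * (t - s)" if u: "u \<in> {s..t}" for u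
    proof -
      have "(\<phi>' has_integral \<phi> t - \<phi> u) {u..t}"
        using u \<phi>(1) by (intro fundamental_theorem_of_calculus)
          (auto simp flip: has_real_derivative_iff_has_vector_derivative intro: DERIV_subset)
      then have "norm (\<phi> t - \<phi> u) \<le> M0 * (t - u)"
        using u st M0 \<open>0 \<le> M0\<close> by (intro has_integral_norm_le_interval) auto
      then have "\<bar>\<phi> t - \<phi> u\<bar> \<le> M0 * (t - s)"
        using u \<open>0 \<le> M0\<close> by (simp add: order_trans[OF _ mult_left_mono])
      then have 1: "\<bar>g u * (\<phi> t - \<phi> u)\<bar> \<le> C * (M0 * (t - s))"
        using g(2) \<open>0 \<le> C\<close> unfolding abs_mult by (intro mult_mono) auto
      have "norm (G u - G s) \<le> C * (u - s)"
        using u st g(2) \<open>0 \<le> C\<close> by (intro has_integral_norm_le_interval[OF G]) auto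
      then have "\<bar>G s - G u\<bar> \<le> C * (t - s)"
        using u \<open>0 \<le> C\<close> by (simp add: abs_minus_commute order_trans[OF _ mult_left_mono])
      then have 2: "\<bar>(G s - G u) * \<phi>' u\<bar> \<le> (C * (t - s)) * M0"
        using M0[of u] u st \<open>0 \<le> C\<close> unfolding abs_mult by (intro mult_mono) auto
      have "g u * \<phi> t + G s * \<phi>' u - ?F u = g u * (\<phi> t - \<phi> u) + (G s - G u) * \<phi>' u"
        by (simp add: algebra_simps)
      moreover have eq: "2 * (C * M0) * (t - s) = C * (M0 * (t - s)) + (C * (t - s)) * M0"
        by (simp add: algebra_simps)
      ultimately show ?thesis
        using 1 2 abs_triangle_ineq[of "g u * (\<phi> t - \<phi> u)" "(G s - G u) * \<phi>' u"]
        unfolding real_norm_def by linarith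
    qed
    have "norm (D t - D s) \<le> 2 * (C * M0) * (t - s) * (t - s)"
      using \<open>0 \<le> C\<close> \<open>0 \<le> M0\<close> st by (intro has_integral_norm_le_interval[OF hi _ _ hb]) auto
    then show "\<bar>D t - D s\<bar> \<le> (2 * (C * M0)) * (t - s)\<^sup>2"
      by (simp add: power2_eq_square mult.assoc)
  qed (rule T)
  then have "integral {0..T} ?F = 0"
    using \<phi>(3,4) by (simp add: D_def)
  then have "(\<integral>t. ?F t \<partial>lebesgue_on {0..T}) = 0"
    using intF by (simp add: lebesgue_integral_eq_integral)
  then show ?thesis
    by (simp add: Bochner_Integration.integral_add[OF int2 int1] eq_neg_iff_add_eq_0)
qed

text \<open>The primitives converge uniformly along a subsequence, by Arzela-Ascoli; the limit is
  Lipschitz and its density is the weak-* limit.\<close>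

proposition bounded_weak_star_subsequence:
  fixes g :: "nat \<Rightarrow> real \<Rightarrow> 'a::euclidean_space"
  assumes T: "0 \<le> T" and C: "0 \<le> C"
    and meas: "\<And>n. g n \<in> borel_measurable (lebesgue_on {0..T})"
    and bound: "\<And>n. AE t in lebesgue_on {0..T}. norm (g n t) \<le> C"
  obtains r g' where "strict_mono (r :: nat \<Rightarrow> nat)"
    "g' \<in> borel_measurable (lebesgue_on {0..T})" "\<And>t. norm (g' t) \<le> C"
    "\<And>\<phi> \<phi>' u. (\<And>t. (\<phi> has_real_derivative \<phi>' t) (at t)) \<Longrightarrow> continuous_on {0..T} \<phi>' \<Longrightarrow> \<phi> 0 = 0 \<Longrightarrow> \<phi> T = 0 \<Longrightarrow>
      (\<lambda>n. \<integral>t. (g (r n) t \<bullet> u) * \<phi> t \<partial>lebesgue_on {0..T}) \<longlonglongrightarrow> (\<integral>t. (g' t \<bullet> u) * \<phi> t \<partial>lebesgue_on {0..T})"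
proof -
  \<comment> \<open>An almost everywhere equal version bounded at every point, so that its
    primitives are \<open>C\<close>-Lipschitz by a pointwise estimate.\<close>
  define k where "k n t = (if norm (g n t) \<le> C then g n t else 0)" for n t
  have k_le: "norm (k n t) \<le> C" for n t
    using C by (simp add: k_def)
  have k_meas: "k n \<in> borel_measurable (lebesgue_on {0..T})" for n
    unfolding k_def using meas[of n] by measurable
  have k_AE: "AE t in lebesgue_on {0..T}. g n t = k n t" for n
    using bound[of n] by (rule eventually_mono) (simp add: k_def)
  have k_int: "k n integrable_on {0..T}" for n
    using integrable_lebesgue_on_bounded[OF k_meas, of n C] k_le by (intro integrable_on_lebesgue_on) auto
  define G where "G n t = integral {0..t} (k n)" for n t
  have G: "(k n has_integral G n b - G n a) {a..b}" if "0 \<le> a" "a \<le> b" "b \<le> T" for n a b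
  proof -
    have "G n b = G n a + integral {a..b} (k n)"
      unfolding G_def using that
      by (intro Henstock_Kurzweil_Integration.integral_combine[symmetric] integrable_on_subinterval[OF k_int]) auto
    moreover have "(k n has_integral integral {a..b} (k n)) {a..b}"
      using that by (intro integrable_integral integrable_on_subinterval[OF k_int]) auto
    ultimately show ?thesis by simp
  qed
  have G_lip: "norm (G n y - G n x) \<le> C * \<bar>y - x\<bar>" if "x \<in> {0..T}" "y \<in> {0..T}" for n x y
    using has_integral_norm_le_interval[OF G[of x y n], of C] has_integral_norm_le_interval[OF G[of y x n], of C] that k_le C
    by (cases x y rule: le_cases) (auto simp: norm_minus_commute)
  have G_le: "norm (G n t) \<le> C * T" if "t \<in> {0..T}" for n t
  proof -
    have "norm (G n t) \<le> C * t"
      using G_lip[of 0 t n] that by (simp add: G_def)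
    also have "\<dots> \<le> C * T" using that C by (simp add: mult_left_mono)
    finally show ?thesis .
  qed
  obtain H r where H: "continuous_on {0..T} H" and r: "strict_mono (r :: nat \<Rightarrow> nat)"
    and lim: "\<And>e. 0 < e \<Longrightarrow> \<exists>N. \<forall>n x. n \<ge> N \<and> x \<in> {0..T} \<longrightarrow> norm (G (r n) x - H x) < e"
  proof (rule Arzela_Ascoli[of "{0..T}" G "C * T"])
    fix x e :: real assume "x \<in> {0..T}" "0 < e"
    show "\<exists>d. 0 < d \<and> (\<forall>n y. y \<in> {0..T} \<and> norm (x - y) < d \<longrightarrow> norm (G n x - G n y) < e)"
    proof (intro exI conjI allI impI)
      show "0 < e / (C + 1)" using \<open>0 < e\<close> C by simp
      fix n y assume y: "y \<in> {0..T} \<and> norm (x - y) < e / (C + 1)"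
      have "norm (G n x - G n y) \<le> C * \<bar>x - y\<bar>"
        using G_lip[of y x n] y \<open>x \<in> {0..T}\<close> by simp
      also have "\<dots> \<le> (C + 1) * \<bar>x - y\<bar>" by (simp add: mult_right_mono)
      also have "\<dots> < e" using y C by (simp add: pos_less_divide_eq mult.commute)
      finally show "norm (G n x - G n y) < e" .
    qed
  qed (use G_le in auto)
  have lim': "(\<lambda>n. G (r n) x) \<longlonglongrightarrow> H x" if "x \<in> {0..T}" for x
    unfolding LIMSEQ_iff using lim that by meson
  \<comment> \<open>Constant extension beyond \<open>[0, T]\<close>: the density result asks for a
    Lipschitz function on the whole line, and clamping does not increase distances.\<close>
  define K where "K t = H (max 0 (min T t))" for t
  have clamp: "max 0 (min T t) \<in> {0..T}" for t using T by auto
  have "C-lipschitz_on UNIV K"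
  proof (rule lipschitz_onI)
    fix x y :: real
    let ?x = "max 0 (min T x)" and ?y = "max 0 (min T y)"
    have "norm (H ?x - H ?y) \<le> C * \<bar>?x - ?y\<bar>"
    proof (rule LIMSEQ_le_const2)
      show "(\<lambda>n. norm (G (r n) ?x - G (r n) ?y)) \<longlonglongrightarrow> norm (H ?x - H ?y)"
        by (intro tendsto_intros lim' clamp)
      show "\<exists>N. \<forall>n\<ge>N. norm (G (r n) ?x - G (r n) ?y) \<le> C * \<bar>?x - ?y\<bar>"
        using G_lip[OF clamp clamp] by blast
    qed
    also have "\<dots> \<le> C * \<bar>x - y\<bar>"
      using C by (intro mult_left_mono) auto
    finally show "dist (K x) (K y) \<le> C * dist x y"
      by (simp add: K_def dist_norm)
  qed (rule C)
  then obtain g' where g': "g' \<in> borel_measurable lebesgue" "\<And>t. norm (g' t) \<le> C"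
    "\<And>a b. a \<le> b \<Longrightarrow> (g' has_integral K b - K a) {a..b}"
    by (rule lipschitz_has_bounded_density) blast
  have g'_meas: "g' \<in> borel_measurable (lebesgue_on {0..T})"
    using g'(1) by (rule measurable_restrict_space1)
  have K_eq: "K t = H t" if "t \<in> {0..T}" for t using that by (simp add: K_def min_absorb2)
  show thesis
  proof (rule that[OF r g'_meas g'(2)])
    fix \<phi> \<phi>' u assume \<phi>: "\<And>t. (\<phi> has_real_derivative \<phi>' t) (at t)" "continuous_on {0..T} \<phi>'" "\<phi> 0 = 0" "\<phi> T = 0"
    have inner_bound: "\<bar>x \<bullet> u\<bar> \<le> B * norm u" if "norm x \<le> B" for x :: 'a and B
      using Cauchy_Schwarz_ineq2[of x u] mult_right_mono[OF that, of "norm u"] by simp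
    \<comment> \<open>Moving the derivative onto \<open>\<phi>\<close> replaces the densities by
      their primitives, for which pointwise convergence and a uniform bound are available. The same
      identity serves each \<open>k n\<close> and the limit.\<close>
    have parts: "(\<integral>t. (f t \<bullet> u) * \<phi> t \<partial>lebesgue_on {0..T}) = - (\<integral>t. (F t \<bullet> u) * \<phi>' t \<partial>lebesgue_on {0..T})"
      if "f \<in> borel_measurable (lebesgue_on {0..T})" "\<And>t. norm (f t) \<le> C"
        "\<And>a b. 0 \<le> a \<Longrightarrow> a \<le> b \<Longrightarrow> b \<le> T \<Longrightarrow> (f has_integral F b - F a) {a..b}" for f F
    proof (rule integral_by_parts_bounded_density[OF T _ _ _ \<phi>])
      show "(\<lambda>t. f t \<bullet> u) \<in> borel_measurable (lebesgue_on {0..T})"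
        using that(1) by (intro borel_measurable_inner) auto
      show "\<bar>f t \<bullet> u\<bar> \<le> C * norm u" for t using that(2) by (rule inner_bound)
      show "((\<lambda>t. f t \<bullet> u) has_integral F b \<bullet> u - F a \<bullet> u) {a..b}" if "0 \<le> a" "a \<le> b" "b \<le> T" for a b
        using has_integral_linear[OF \<open>\<And>a b. _ \<Longrightarrow> _ \<Longrightarrow> _ \<Longrightarrow> (f has_integral F b - F a) {a..b}\<close>[OF that] bounded_linear_inner_left[of u]]
        by (simp add: o_def inner_diff_left)
    qed
    have "(\<integral>t. (g n t \<bullet> u) * \<phi> t \<partial>lebesgue_on {0..T}) = (\<integral>t. (k n t \<bullet> u) * \<phi> t \<partial>lebesgue_on {0..T})" for n
    proof (rule integral_cong_AE)
      have "continuous_on UNIV \<phi>"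
        using \<phi>(1) by (meson DERIV_isCont continuous_at_imp_continuous_on)
      then have "\<phi> \<in> borel_measurable (lebesgue_on {0..T})"
        by (intro continuous_imp_measurable_on_sets_lebesgue) (auto intro: continuous_on_subset)
      then show "(\<lambda>t. (g n t \<bullet> u) * \<phi> t) \<in> borel_measurable (lebesgue_on {0..T})"
        "(\<lambda>t. (k n t \<bullet> u) * \<phi> t) \<in> borel_measurable (lebesgue_on {0..T})"
        using meas k_meas by (auto intro!: borel_measurable_times borel_measurable_inner)
      show "AE t in lebesgue_on {0..T}. (g n t \<bullet> u) * \<phi> t = (k n t \<bullet> u) * \<phi> t"
        using k_AE[of n] by (rule eventually_mono) simp
    qed
    also have "(\<integral>t. (k n t \<bullet> u) * \<phi> t \<partial>lebesgue_on {0..T}) = - (\<integral>t. (G n t \<bullet> u) * \<phi>' t \<partial>lebesgue_on {0..T})" for n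
      by (rule parts) (auto intro: k_meas k_le G)
    finally have left: "(\<integral>t. (g n t \<bullet> u) * \<phi> t \<partial>lebesgue_on {0..T}) = - (\<integral>t. (G n t \<bullet> u) * \<phi>' t \<partial>lebesgue_on {0..T})" for n .
    have "(\<integral>t. (g' t \<bullet> u) * \<phi> t \<partial>lebesgue_on {0..T}) = - (\<integral>t. (K t \<bullet> u) * \<phi>' t \<partial>lebesgue_on {0..T})"
      by (rule parts) (auto intro: g'_meas g')
    also have "(\<integral>t. (K t \<bullet> u) * \<phi>' t \<partial>lebesgue_on {0..T}) = (\<integral>t. (H t \<bullet> u) * \<phi>' t \<partial>lebesgue_on {0..T})"
      by (rule Bochner_Integration.integral_cong) (auto simp: K_eq)
    finally have right: "(\<integral>t. (g' t \<bullet> u) * \<phi> t \<partial>lebesgue_on {0..T}) = - (\<integral>t. (H t \<bullet> u) * \<phi>' t \<partial>lebesgue_on {0..T})" .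
    have "bounded (\<phi>' ` {0..T})"
      using \<phi>(2) by (auto intro!: compact_imp_bounded compact_continuous_image)
    then obtain M where M: "\<And>t. t \<in> {0..T} \<Longrightarrow> \<bar>\<phi>' t\<bar> \<le> M"
      unfolding bounded_iff by (metis image_eqI real_norm_def)
    have "continuous_on {0..T} (G n)" for n
    proof (rule lipschitz_on_continuous_on)
      show "C-lipschitz_on {0..T} (G n)"
        using G_lip C by (intro lipschitz_onI) (auto simp: dist_norm)
    qed
    then show "(\<lambda>n. \<integral>t. (g (r n) t \<bullet> u) * \<phi> t \<partial>lebesgue_on {0..T}) \<longlonglongrightarrow> (\<integral>t. (g' t \<bullet> u) * \<phi> t \<partial>lebesgue_on {0..T})"
      unfolding left right using lim' H \<phi>(2)
    proof (intro tendsto_minus finite_measure.tendsto_integral_bounded[where C="C * T * norm u * M"])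
      show "\<bar>(G (r n) t \<bullet> u) * \<phi>' t\<bar> \<le> C * T * norm u * M" if "t \<in> space (lebesgue_on {0..T})" for n t
        using inner_bound[OF G_le, of t "r n"] M[of t] that C T
        unfolding abs_mult by (intro mult_mono) (auto simp: space_restrict_space)
    qed (auto intro!: tendsto_intros continuous_imp_measurable_on_sets_lebesgue continuous_intros
        finite_measure_lebesgue_on simp: space_restrict_space)
  qed
qed

section \<open>Compactness of the set of curves\<close>

lemma ess_norm_leI:
  assumes "g \<in> borel_measurable (lebesgue_on {0..T})" "\<And>t. t \<in> {0..T} \<Longrightarrow> norm (g t) \<le> a"
  shows "ess_norm T g \<le> ereal a"
  unfolding ess_norm_def
proof (rule esssup_I)
  show "(\<lambda>t. ereal (norm (g t))) \<in> borel_measurable (lebesgue_on {0..T})"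
    using measurable_compose[OF assms(1) borel_measurable_norm] by (rule borel_measurable_ereal)
  show "AE t in lebesgue_on {0..T}. ereal (norm (g t)) \<le> ereal a"
    using assms(2) by (intro AE_I2) (simp add: space_restrict_space)
qed

lemma L_inftyI:
  assumes "f \<in> borel_measurable (lebesgue_on {0..T})" "\<And>t. t \<in> {0..T} \<Longrightarrow> \<bar>f t\<bar> \<le> C"
  shows "f \<in> L_infty T"
proof -
  have "ess_norm T f \<le> ereal C"
    using assms by (intro ess_norm_leI) simp_all
  also have "ereal C < \<infinity>" by simp
  finally show ?thesis using assms(1) unfolding L_infty_def by blast
qed

lemma ess_norm_leD:
  assumes "ess_norm T g \<le> ereal a"
  shows "AE t in lebesgue_on {0..T}. norm (g t) \<le> a"
proof -
  have "AE t in lebesgue_on {0..T}. ereal (norm (g t)) \<le> ess_norm T g"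
    unfolding ess_norm_def by (rule esssup_AE)
  then show ?thesis
    by (rule eventually_mono) (metis assms ereal_less_eq(3) order_trans)
qed

lemma borel_measurable_vecI:
  fixes g :: "'a \<Rightarrow> real ^ 'd"
  assumes "\<And>j. (\<lambda>t. g t $ j) \<in> borel_measurable M"
  shows "g \<in> borel_measurable M"
  unfolding borel_measurable_euclidean_space[of g M]
proof
  fix b :: "real ^ 'd" assume "b \<in> Basis"
  then obtain j where "b = axis j 1" by (auto simp: Basis_vec_def)
  then show "(\<lambda>t. g t \<bullet> b) \<in> borel_measurable M"
    using assms[of j] by (simp add: inner_axis)
qed

section \<open>Test functions, weak derivatives and their limits\<close>

lemma test_function_differentiable:
  assumes "test_function T \<phi>"
  shows "((deriv ^^ k) \<phi> has_real_derivative (deriv ^^ Suc k) \<phi> t) (at t)"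
    and "continuous_on A ((deriv ^^ k) \<phi>)"
proof -
  have k: "(deriv ^^ k) \<phi> differentiable_on UNIV"
    using assms by (auto simp: test_function_def)
  then show "((deriv ^^ k) \<phi> has_real_derivative (deriv ^^ Suc k) \<phi> t) (at t)"
    by (simp add: differentiable_on_UNIV_real_iff)
  show "continuous_on A ((deriv ^^ k) \<phi>)"
    using differentiable_imp_continuous_on[OF k] continuous_on_subset by blast
qed

text \<open>Off its closed support the function is locally zero, so every derivative vanishes there;
  the support stays away from 0 and \<open>T\<close>. This removes all boundary terms.\<close>

lemma test_function_boundary:
  assumes "test_function T \<phi>" "t \<notin> {0<..<T}"
  shows "(deriv ^^ k) \<phi> t = 0"
proof -
  let ?U = "- closure {t. \<phi> t \<noteq> 0}"
  have zero: "(deriv ^^ k) \<phi> x = 0" if "x \<in> ?U" for x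
    using that
  proof (induction k arbitrary: x)
    case 0
    then show ?case using closure_subset[of "{t. \<phi> t \<noteq> 0}"] by auto
  next
    case (Suc k)
    have "((deriv ^^ k) \<phi> has_real_derivative 0) (at x)"
      by (rule has_field_derivative_transform_within_open[of "\<lambda>_. 0" 0 x ?U])
        (use Suc in \<open>auto simp: open_Compl\<close>)
    then show ?case by (simp add: DERIV_imp_deriv)
  qed
  have "t \<in> ?U" using assms unfolding test_function_def by blast
  then show ?thesis by (rule zero)
qed

text \<open>Weak derivatives of order at least 1 do not see constants: the \<open>i\<close>-th
  derivative of a test function has integral 0, as its primitive of order \<open>i - 1\<close>
  vanishes at both ends. This is what permits translating lifts.\<close>

lemma has_weak_deriv_diff_const:
  assumes T: "0 < T" and i: "1 \<le> i" and f: "continuous_on {0..T} f" and weak: "has_weak_deriv T i f g"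
  shows "has_weak_deriv T i (\<lambda>t. f t - c) g"
  unfolding has_weak_deriv_def
proof (intro allI impI)
  fix \<phi> assume \<phi>: "test_function T \<phi>"
  obtain k where k: "i = Suc k" using i by (cases i) auto
  have "((deriv ^^ i) \<phi> has_integral (deriv ^^ k) \<phi> T - (deriv ^^ k) \<phi> 0) {0..T}"
    using T test_function_differentiable(1)[OF \<phi>, of k] unfolding k
    by (intro fundamental_theorem_of_calculus)
      (auto simp flip: has_real_derivative_iff_has_vector_derivative simp del: funpow.simps intro: DERIV_subset)
  then have "((deriv ^^ i) \<phi> has_integral 0) {0..T}"
    using test_function_boundary[OF \<phi>, of T k] test_function_boundary[OF \<phi>, of 0 k] by simp
  moreover have int: "integrable (lebesgue_on {0..T}) ((deriv ^^ i) \<phi>)"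
    by (intro continuous_imp_integrable_real test_function_differentiable(2)[OF \<phi>])
  ultimately have "(\<integral>t. (deriv ^^ i) \<phi> t \<partial>lebesgue_on {0..T}) = 0"
    by (simp add: lebesgue_integral_eq_integral integral_unique)
  moreover have "integrable (lebesgue_on {0..T}) (\<lambda>t. f t * (deriv ^^ i) \<phi> t)"
    by (intro continuous_imp_integrable_real continuous_on_mult f test_function_differentiable(2)[OF \<phi>])
  ultimately have "(\<integral>t. (f t - c) * (deriv ^^ i) \<phi> t \<partial>lebesgue_on {0..T}) = (\<integral>t. f t * (deriv ^^ i) \<phi> t \<partial>lebesgue_on {0..T})"
    using int by (simp add: left_diff_distrib Bochner_Integration.integral_diff)
  then show "(\<integral>t. (f t - c) * (deriv ^^ i) \<phi> t \<partial>lebesgue_on {0..T}) = (- 1) ^ i * (\<integral>t. g t * \<phi> t \<partial>lebesgue_on {0..T})"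
    using weak \<phi> by (simp add: has_weak_deriv_def)
qed

text \<open>Only finitely many properties have to hold at once, so successive extraction is enough
  and no diagonal sequence is formed; \<open>sub\<close> keeps what was gained earlier.\<close>

lemma common_subsequence:
  fixes P :: "nat \<Rightarrow> (nat \<Rightarrow> nat) \<Rightarrow> bool"
  assumes ex: "\<And>i (s :: nat \<Rightarrow> nat). strict_mono s \<Longrightarrow> \<exists>r. strict_mono r \<and> P i (s \<circ> r)"
    and sub: "\<And>i (s :: nat \<Rightarrow> nat) r. P i s \<Longrightarrow> strict_mono r \<Longrightarrow> P i (s \<circ> r)"
  obtains s where "strict_mono s" "\<And>i. i \<le> m \<Longrightarrow> P i s"
proof -
  have ind: "\<exists>s. strict_mono s \<and> (\<forall>i<k. P i s)" for k
  proof (induction k)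
    case 0
    show ?case by (rule exI[of _ id]) (simp add: strict_mono_def)
  next
    case (Suc k)
    then obtain s where s: "strict_mono s" "\<forall>i<k. P i s" by blast
    obtain r where r: "strict_mono r" "P k (s \<circ> r)" using ex[OF s(1)] by blast
    have "P i (s \<circ> r)" if "i < Suc k" for i
      using that s(2) r sub by (cases "i = k") auto
    then show ?case using strict_mono_o[OF s(1) r(1)] by blast
  qed
  obtain s where s: "strict_mono s" "\<forall>i<Suc m. P i s" using ind by blast
  show thesis
  proof (rule that[OF s(1)])
    show "P i s" if "i \<le> m" for i using s(2) that by simp
  qed
qed

text \<open>Weak-* convergence tested only against smooth compactly supported functions times fixed
  vectors, which is all that the identity of weak derivatives can detect.\<close>

definition weak_limit :: "real \<Rightarrow> (nat \<Rightarrow> real \<Rightarrow> 'a::euclidean_space) \<Rightarrow> (real \<Rightarrow> 'a) \<Rightarrow> bool"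
  where "weak_limit T g g' \<longleftrightarrow> (\<forall>\<phi> u. test_function T \<phi> \<longrightarrow>
    (\<lambda>n. \<integral>t. (g n t \<bullet> u) * \<phi> t \<partial>lebesgue_on {0..T}) \<longlonglongrightarrow> (\<integral>t. (g' t \<bullet> u) * \<phi> t \<partial>lebesgue_on {0..T}))"

lemma weak_limit_subsequence:
  assumes "weak_limit T g g'" "strict_mono r"
  shows "weak_limit T (\<lambda>n. g (r n)) g'"
  unfolding weak_limit_def
proof (intro allI impI)
  fix \<phi> u assume "test_function T \<phi>"
  then have "(\<lambda>n. \<integral>t. (g n t \<bullet> u) * \<phi> t \<partial>lebesgue_on {0..T}) \<longlonglongrightarrow> (\<integral>t. (g' t \<bullet> u) * \<phi> t \<partial>lebesgue_on {0..T})"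
    using assms(1) by (simp add: weak_limit_def)
  from LIMSEQ_subseq_LIMSEQ[OF this assms(2)]
  show "(\<lambda>n. \<integral>t. (g (r n) t \<bullet> u) * \<phi> t \<partial>lebesgue_on {0..T}) \<longlonglongrightarrow> (\<integral>t. (g' t \<bullet> u) * \<phi> t \<partial>lebesgue_on {0..T})"
    by (simp add: o_def)
qed

lemma weak_limit_exists:
  fixes g :: "nat \<Rightarrow> real \<Rightarrow> 'a::euclidean_space"
  assumes "0 \<le> T" "0 \<le> C"
    and "\<And>n. g n \<in> borel_measurable (lebesgue_on {0..T})"
    and "\<And>n. AE t in lebesgue_on {0..T}. norm (g n t) \<le> C"
  obtains r g' where "strict_mono (r :: nat \<Rightarrow> nat)" "g' \<in> borel_measurable (lebesgue_on {0..T})"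
    "\<And>t. norm (g' t) \<le> C" "weak_limit T (\<lambda>n. g (r n)) g'"
proof (rule bounded_weak_star_subsequence[OF assms])
  fix r g'
  assume *: "strict_mono (r :: nat \<Rightarrow> nat)" "g' \<in> borel_measurable (lebesgue_on {0..T})" "\<And>t. norm (g' t) \<le> C"
    "\<And>\<phi> \<phi>' u. (\<And>t. (\<phi> has_real_derivative \<phi>' t) (at t)) \<Longrightarrow> continuous_on {0..T} \<phi>' \<Longrightarrow> \<phi> 0 = 0 \<Longrightarrow> \<phi> T = 0 \<Longrightarrow>
      (\<lambda>n. \<integral>t. (g (r n) t \<bullet> u) * \<phi> t \<partial>lebesgue_on {0..T}) \<longlonglongrightarrow> (\<integral>t. (g' t \<bullet> u) * \<phi> t \<partial>lebesgue_on {0..T})"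
  have "weak_limit T (\<lambda>n. g (r n)) g'"
    unfolding weak_limit_def
  proof (intro allI impI)
    fix \<phi> u assume \<phi>: "test_function T \<phi>"
    show "(\<lambda>n. \<integral>t. (g (r n) t \<bullet> u) * \<phi> t \<partial>lebesgue_on {0..T}) \<longlonglongrightarrow> (\<integral>t. (g' t \<bullet> u) * \<phi> t \<partial>lebesgue_on {0..T})"
    proof (rule *(4))
      show "(\<phi> has_real_derivative deriv \<phi> t) (at t)" for t
        using test_function_differentiable(1)[OF \<phi>, of 0] by simp
      show "continuous_on {0..T} (deriv \<phi>)"
        using test_function_differentiable(2)[OF \<phi>, of _ 1] by simp
      show "\<phi> 0 = 0" "\<phi> T = 0"
        using test_function_boundary[OF \<phi>, of _ 0] by auto
    qed
  qed
  then show thesis by (rule that[OF *(1-3)])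
qed

text \<open>For every order the derivatives sit on the fixed test function. The left side therefore
  needs only bounded pointwise convergence of \<open>q n\<close>, and the right side is the weak
  limit tested with \<open>axis j 1\<close>.\<close>

lemma has_weak_deriv_limit:
  fixes q :: "nat \<Rightarrow> real \<Rightarrow> real ^ 'd" and Q :: "real \<Rightarrow> real ^ 'd"
  assumes cont: "\<And>n. continuous_on {0..T} (q n)" "continuous_on {0..T} Q"
    and bound: "\<And>n t. t \<in> {0..T} \<Longrightarrow> norm (q n t) \<le> B"
    and lim: "\<And>t. t \<in> {0..T} \<Longrightarrow> (\<lambda>n. q n t) \<longlonglongrightarrow> Q t"
    and weak: "\<And>n. has_weak_deriv T i (\<lambda>t. q n t $ j) (\<lambda>t. g n t $ j)" and g: "weak_limit T g g'"
  shows "has_weak_deriv T i (\<lambda>t. Q t $ j) (\<lambda>t. g' t $ j)"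
  unfolding has_weak_deriv_def
proof (intro allI impI)
  fix \<phi> assume \<phi>: "test_function T \<phi>"
  have cont\<phi>: "continuous_on {0..T} ((deriv ^^ i) \<phi>)"
    by (rule test_function_differentiable[OF \<phi>])
  then have "bounded ((deriv ^^ i) \<phi> ` {0..T})"
    by (intro compact_imp_bounded compact_continuous_image) auto
  then obtain M where M: "\<And>t. t \<in> {0..T} \<Longrightarrow> \<bar>(deriv ^^ i) \<phi> t\<bar> \<le> M"
    unfolding bounded_iff by (metis image_eqI real_norm_def)
  have "finite_measure (lebesgue_on {0..T})" by (simp add: finite_measure_lebesgue_on)
  then have "(\<lambda>n. \<integral>t. q n t $ j * (deriv ^^ i) \<phi> t \<partial>lebesgue_on {0..T}) \<longlonglongrightarrow> (\<integral>t. Q t $ j * (deriv ^^ i) \<phi> t \<partial>lebesgue_on {0..T})"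
  proof (rule finite_measure.tendsto_integral_bounded)
    show "(\<lambda>t. q n t $ j * (deriv ^^ i) \<phi> t) \<in> borel_measurable (lebesgue_on {0..T})" for n
      by (intro continuous_imp_measurable_on_sets_lebesgue continuous_on_mult cont cont\<phi> continuous_on_component) auto
    show "(\<lambda>t. Q t $ j * (deriv ^^ i) \<phi> t) \<in> borel_measurable (lebesgue_on {0..T})"
      by (intro continuous_imp_measurable_on_sets_lebesgue continuous_on_mult cont cont\<phi> continuous_on_component) auto
    fix t assume "t \<in> space (lebesgue_on {0..T})"
    then have t: "t \<in> {0..T}" by (simp add: space_restrict_space)
    show "\<bar>q n t $ j * (deriv ^^ i) \<phi> t\<bar> \<le> B * M" for n
      using order_trans[OF component_le_norm_cart bound[OF t]] M[OF t] order_trans[OF norm_ge_zero bound[OF t]]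
      unfolding abs_mult by (intro mult_mono) auto
    show "(\<lambda>n. q n t $ j * (deriv ^^ i) \<phi> t) \<longlonglongrightarrow> Q t $ j * (deriv ^^ i) \<phi> t"
      by (intro tendsto_intros lim t)
  qed
  moreover have "(\<lambda>n. \<integral>t. g n t $ j * \<phi> t \<partial>lebesgue_on {0..T}) \<longlonglongrightarrow> (\<integral>t. g' t $ j * \<phi> t \<partial>lebesgue_on {0..T})"
    using g[unfolded weak_limit_def, rule_format, OF \<phi>, of "axis j 1"] by (simp add: inner_axis)
  then have "(\<lambda>n. (- 1) ^ i * (\<integral>t. g n t $ j * \<phi> t \<partial>lebesgue_on {0..T})) \<longlonglongrightarrow> (- 1) ^ i * (\<integral>t. g' t $ j * \<phi> t \<partial>lebesgue_on {0..T})"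
    by (rule tendsto_mult_left)
  moreover have "(\<integral>t. q n t $ j * (deriv ^^ i) \<phi> t \<partial>lebesgue_on {0..T}) = (- 1) ^ i * (\<integral>t. g n t $ j * \<phi> t \<partial>lebesgue_on {0..T})" for n
    using weak \<phi> by (simp add: has_weak_deriv_def)
  ultimately show "(\<integral>t. Q t $ j * (deriv ^^ i) \<phi> t \<partial>lebesgue_on {0..T}) = (- 1) ^ i * (\<integral>t. g' t $ j * \<phi> t \<partial>lebesgue_on {0..T})"
    by (simp add: LIMSEQ_unique)
qed

text \<open>Integer translations bring the lifts into a fixed bounded set, without changing the curves.\<close>

lemma normalized_lift:
  fixes p :: "real \<Rightarrow> ('d::finite) torus"
  assumes p: "p \<in> curves T m \<alpha>" and T: "0 < T" and m: "1 \<le> m"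
  obtains q :: "real \<Rightarrow> real ^ 'd" and g :: "nat \<Rightarrow> real \<Rightarrow> real ^ 'd"
  where "\<And>t. t \<in> {0..T} \<Longrightarrow> p t = torus_proj (q t)" "norm (q 0) \<le> real CARD('d)"
    "(real CARD('d) * \<alpha> 1)-lipschitz_on {0..T} q"
    "\<And>i. i \<in> {1..m} \<Longrightarrow> g i \<in> borel_measurable (lebesgue_on {0..T})"
    "\<And>i. i \<in> {1..m} \<Longrightarrow> AE t in lebesgue_on {0..T}. norm (g i t) \<le> \<alpha> i"
    "\<And>i j. i \<in> {1..m} \<Longrightarrow> has_weak_deriv T i (\<lambda>t. q t $ j) (\<lambda>t. g i t $ j)"
proof -
  obtain q0 :: "real \<Rightarrow> real ^ 'd" where q0: "continuous_on {0..T} q0" "\<And>t. t \<in> {0..T} \<Longrightarrow> p t = torus_proj (q0 t)"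
    and ex: "\<forall>i\<in>{1..m}. \<exists>g :: real \<Rightarrow> real ^ 'd.
      (\<forall>j. (\<lambda>t. g t $ j) \<in> L_infty T \<and> has_weak_deriv T i (\<lambda>t. q0 t $ j) (\<lambda>t. g t $ j)) \<and> ess_norm T g \<le> ereal (\<alpha> i)"
    using p unfolding curves_def by blast
  obtain g :: "nat \<Rightarrow> real \<Rightarrow> real ^ 'd" where g: "\<And>i j. i \<in> {1..m} \<Longrightarrow> (\<lambda>t. g i t $ j) \<in> L_infty T"
      "\<And>i j. i \<in> {1..m} \<Longrightarrow> has_weak_deriv T i (\<lambda>t. q0 t $ j) (\<lambda>t. g i t $ j)"
      "\<And>i. i \<in> {1..m} \<Longrightarrow> ess_norm T (g i) \<le> ereal (\<alpha> i)"
    using bchoice[OF ex] by blast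
  have g_AE: "AE t in lebesgue_on {0..T}. norm (g i t) \<le> \<alpha> i" if "i \<in> {1..m}" for i
    using g(3)[OF that] by (rule ess_norm_leD)
  have g_meas: "g i \<in> borel_measurable (lebesgue_on {0..T})" if "i \<in> {1..m}" for i
    using g(1)[OF that] by (intro borel_measurable_vecI) (simp add: L_infty_def)
  \<comment> \<open>After subtracting the integer parts at time 0, every coordinate of
    \<open>q 0\<close> lies in [0, 1), whence the bound by the dimension.\<close>
  define z :: "real ^ 'd" where "z = (\<chi> j. of_int \<lfloor>q0 0 $ j\<rfloor>)"
  define q where "q t = q0 t - z" for t
  have cont: "continuous_on {0..T} (\<lambda>t. q0 t $ j)" for j
    using q0(1) by (rule continuous_on_component)
  have weak: "has_weak_deriv T i (\<lambda>t. q t $ j) (\<lambda>t. g i t $ j)" if "i \<in> {1..m}" for i j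
    using has_weak_deriv_diff_const[OF T _ cont g(2)[OF that]] that by (simp add: q_def)
  have lip: "(\<alpha> 1)-lipschitz_on {0..T} (\<lambda>t. q t $ j)" for j
  proof (rule weak_deriv_imp_lipschitz[OF T])
    show "continuous_on {0..T} (\<lambda>t. q t $ j)"
      unfolding q_def vector_minus_component by (intro continuous_on_diff cont continuous_on_const)
    show "(\<lambda>t. g 1 t $ j) \<in> borel_measurable (lebesgue_on {0..T})"
      using g(1)[of 1] m by (simp add: L_infty_def)
    have "AE t in lebesgue_on {0..T}. norm (g 1 t) \<le> \<alpha> 1"
      using m by (intro g_AE) auto
    then show "AE t in lebesgue_on {0..T}. \<bar>g 1 t $ j\<bar> \<le> \<alpha> 1"
      by (rule eventually_mono) (rule order_trans[OF component_le_norm_cart])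
    show "has_weak_deriv T 1 (\<lambda>t. q t $ j) (\<lambda>t. g 1 t $ j)"
      using m by (intro weak) auto
  qed
  show thesis
  proof (rule that[OF _ _ _ g_meas g_AE weak])
    show "p t = torus_proj (q t)" if "t \<in> {0..T}" for t
      unfolding q0(2)[OF that] torus_proj_eq_iff by (simp add: q_def z_def)
    have "norm (q 0) \<le> (\<Sum>j\<in>UNIV. \<bar>q 0 $ j\<bar>)" by (rule norm_le_l1_cart)
    also have "\<dots> \<le> (\<Sum>j\<in>(UNIV :: 'd set). 1)"
      by (intro sum_mono) (simp add: q_def z_def abs_le_iff; linarith)
    finally show "norm (q 0) \<le> real CARD('d)" by simp
    \<comment> \<open>Summing over coordinates costs the factor \<open>CARD('d)\<close>. This
      constant serves only equicontinuity; the exact bounds \<open>\<alpha> i\<close> are carried by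
      the functions \<open>g i\<close>.\<close>
    show "(real CARD('d) * \<alpha> 1)-lipschitz_on {0..T} q"
    proof (rule lipschitz_onI)
      fix x y assume xy: "x \<in> {0..T}" "y \<in> {0..T}"
      have "dist (q x) (q y) \<le> (\<Sum>j\<in>UNIV. \<bar>(q x - q y) $ j\<bar>)"
        unfolding dist_norm by (rule norm_le_l1_cart)
      also have "\<dots> \<le> (\<Sum>j\<in>(UNIV :: 'd set). \<alpha> 1 * dist x y)"
        using lipschitz_onD[OF lip xy] by (intro sum_mono) (simp add: dist_real_def)
      finally show "dist (q x) (q y) \<le> real CARD('d) * \<alpha> 1 * dist x y" by simp
    qed (use lipschitz_on_nonneg[OF lip] in simp)
  qed
qed

text \<open>Convergence is expressed through continuous real functions of the curve, exactly the
  form in which the discrepancy uses it. The limit curve is the projection of a uniform limit of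
  normalized lifts.\<close>

proposition curves_sequentially_compact:
  fixes p :: "nat \<Rightarrow> real \<Rightarrow> ('d::finite) torus"
  assumes p: "\<And>n. p n \<in> curves T m \<alpha>" and T: "0 < T" and m: "1 \<le> m"
    and \<alpha>: "\<And>i. i \<in> {1..m} \<Longrightarrow> 0 \<le> \<alpha> i"
  obtains r p' where "strict_mono (r :: nat \<Rightarrow> nat)" "p' \<in> curves T m \<alpha>"
    "\<And>(h :: 'd torus \<Rightarrow> real) t. continuous_on UNIV h \<Longrightarrow> t \<in> {0..T} \<Longrightarrow> (\<lambda>n. h (p (r n) t)) \<longlonglongrightarrow> h (p' t)"
proof -
  define lift where "lift n q g \<longleftrightarrow> (\<forall>t\<in>{0..T}. p n t = torus_proj (q t)) \<and> norm (q 0) \<le> real CARD('d) \<and>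
      (real CARD('d) * \<alpha> 1)-lipschitz_on {0..T} q \<and>
      (\<forall>i\<in>{1..m}. g i \<in> borel_measurable (lebesgue_on {0..T}) \<and>
        (AE t in lebesgue_on {0..T}. norm (g i t) \<le> \<alpha> i) \<and>
        (\<forall>j. has_weak_deriv T i (\<lambda>t. q t $ j) (\<lambda>t. g i t $ j)))"
    for n and q :: "real \<Rightarrow> real ^ 'd" and g :: "nat \<Rightarrow> real \<Rightarrow> real ^ 'd"
  have "\<exists>q g. lift n q g" for n
  proof (rule normalized_lift[OF p[of n] T m])
    fix q :: "real \<Rightarrow> real ^ 'd" and g :: "nat \<Rightarrow> real \<Rightarrow> real ^ 'd"
    assume "\<And>t. t \<in> {0..T} \<Longrightarrow> p n t = torus_proj (q t)" "norm (q 0) \<le> real CARD('d)"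
      "(real CARD('d) * \<alpha> 1)-lipschitz_on {0..T} q"
      "\<And>i. i \<in> {1..m} \<Longrightarrow> g i \<in> borel_measurable (lebesgue_on {0..T})"
      "\<And>i. i \<in> {1..m} \<Longrightarrow> AE t in lebesgue_on {0..T}. norm (g i t) \<le> \<alpha> i"
      "\<And>i j. i \<in> {1..m} \<Longrightarrow> has_weak_deriv T i (\<lambda>t. q t $ j) (\<lambda>t. g i t $ j)"
    then have "lift n q g" unfolding lift_def by blast
    then show ?thesis by blast
  qed
  then obtain q g where qg: "\<And>n. lift n (q n) (g n)" by metis
  have q: "p n t = torus_proj (q n t)" if "t \<in> {0..T}" for n t
    using qg that by (auto simp: lift_def)
  have q0: "norm (q n 0) \<le> real CARD('d)" and lip: "(real CARD('d) * \<alpha> 1)-lipschitz_on {0..T} (q n)" for n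
    using qg[of n] by (auto simp: lift_def)
  have g: "g n i \<in> borel_measurable (lebesgue_on {0..T})" "AE t in lebesgue_on {0..T}. norm (g n i t) \<le> \<alpha> i"
    "has_weak_deriv T i (\<lambda>t. q n t $ j) (\<lambda>t. g n i t $ j)" if "i \<in> {1..m}" for n i j
    using qg[of n] that by (auto simp: lift_def)
  define L where "L = real CARD('d) * \<alpha> 1"
  have L: "0 \<le> L" and q_lip: "norm (q n x - q n y) \<le> L * \<bar>x - y\<bar>" if "x \<in> {0..T}" "y \<in> {0..T}" for n x y
    using lipschitz_on_nonneg[OF lip[of n]] lipschitz_onD[OF lip[of n] that]
    by (simp_all add: L_def dist_norm)
  then have "0 \<le> L" using T by force
  define B where "B = real CARD('d) + L * T"
  have q_bound: "norm (q n t) \<le> B" if "t \<in> {0..T}" for n t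
  proof -
    have "norm (q n t) \<le> norm (q n 0) + norm (q n t - q n 0)"
      by (rule norm_triangle_sub)
    also have "norm (q n t - q n 0) \<le> L * T"
      using q_lip[of t 0 n] that \<open>0 \<le> L\<close> T mult_left_mono[of t T L] by simp
    finally show ?thesis using q0[of n] by (simp add: B_def)
  qed
  obtain Q r where Q: "continuous_on {0..T} Q" and r: "strict_mono (r :: nat \<Rightarrow> nat)"
    and lim: "\<And>e. 0 < e \<Longrightarrow> \<exists>N. \<forall>n x. n \<ge> N \<and> x \<in> {0..T} \<longrightarrow> norm (q (r n) x - Q x) < e"
  proof (rule Arzela_Ascoli[of "{0..T}" q B])
    fix x e :: real assume "x \<in> {0..T}" "0 < e"
    show "\<exists>d. 0 < d \<and> (\<forall>n y. y \<in> {0..T} \<and> norm (x - y) < d \<longrightarrow> norm (q n x - q n y) < e)"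
    proof (intro exI conjI allI impI)
      show "0 < e / (L + 1)" using \<open>0 < e\<close> \<open>0 \<le> L\<close> by simp
      fix n y assume y: "y \<in> {0..T} \<and> norm (x - y) < e / (L + 1)"
      have "norm (q n x - q n y) \<le> L * \<bar>x - y\<bar>"
        using q_lip y \<open>x \<in> {0..T}\<close> by simp
      also have "\<dots> \<le> (L + 1) * \<bar>x - y\<bar>" by (simp add: mult_right_mono)
      also have "\<dots> < e" using y \<open>0 \<le> L\<close> by (simp add: pos_less_divide_eq mult.commute)
      finally show "norm (q n x - q n y) < e" .
    qed
  qed (use q_bound in auto)
  have lim': "(\<lambda>n. q (r n) t) \<longlonglongrightarrow> Q t" if "t \<in> {0..T}" for t
    unfolding LIMSEQ_iff using lim that by meson
  \<comment> \<open>The guard makes the property trivial for the index 0, which the extraction over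
    all \<open>i \<le> m\<close> also visits.\<close>
  define W where "W i s \<longleftrightarrow> i \<in> {1..m} \<longrightarrow> (\<exists>g'. g' \<in> borel_measurable (lebesgue_on {0..T}) \<and>
      (\<forall>t. norm (g' t) \<le> \<alpha> i) \<and> weak_limit T (\<lambda>n. g (r (s n)) i) g')" for i s
  have W_ex: "\<exists>r. strict_mono r \<and> W i (s \<circ> r)" if "strict_mono s" for i and s :: "nat \<Rightarrow> nat"
  proof (cases "i \<in> {1..m}")
    case True
    show ?thesis
    proof (rule weak_limit_exists[of T "\<alpha> i" "\<lambda>n. g (r (s n)) i"])
      fix k g' assume "strict_mono (k :: nat \<Rightarrow> nat)" "g' \<in> borel_measurable (lebesgue_on {0..T})"
        "\<And>t. norm (g' t) \<le> \<alpha> i" "weak_limit T (\<lambda>n. g (r (s (k n))) i) g'"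
      then show ?thesis by (intro exI[of _ k]) (auto simp: W_def)
    qed (use T \<alpha>[OF True] g(1,2)[OF True] in auto)
  next
    case False
    then show ?thesis by (intro exI[of _ id]) (auto simp: W_def strict_mono_def)
  qed
  have W_sub: "W i (s \<circ> k)" if "W i s" "strict_mono k" for i s and k :: "nat \<Rightarrow> nat"
    unfolding W_def
  proof
    assume "i \<in> {1..m}"
    with \<open>W i s\<close> obtain g' where g': "g' \<in> borel_measurable (lebesgue_on {0..T})" "\<forall>t. norm (g' t) \<le> \<alpha> i"
        "weak_limit T (\<lambda>n. g (r (s n)) i) g'"
      by (auto simp: W_def)
    show "\<exists>g'. g' \<in> borel_measurable (lebesgue_on {0..T}) \<and> (\<forall>t. norm (g' t) \<le> \<alpha> i) \<and>
        weak_limit T (\<lambda>n. g (r ((s \<circ> k) n)) i) g'"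
      using g'(1,2) weak_limit_subsequence[OF g'(3) \<open>strict_mono k\<close>] by (intro exI[of _ g']) simp
  qed
  obtain s :: "nat \<Rightarrow> nat" where s: "strict_mono s" "\<And>i. i \<le> m \<Longrightarrow> W i s"
    using common_subsequence[of W m, OF W_ex W_sub] by blast
  have lims: "(\<lambda>n. q (r (s n)) t) \<longlonglongrightarrow> Q t" if "t \<in> {0..T}" for t
    using LIMSEQ_subseq_LIMSEQ[OF lim'[OF that] s(1)] by (simp add: o_def)
  have weak: "\<exists>g' :: real \<Rightarrow> real ^ 'd. (\<forall>j. (\<lambda>t. g' t $ j) \<in> L_infty T \<and> has_weak_deriv T i (\<lambda>t. Q t $ j) (\<lambda>t. g' t $ j)) \<and>
      ess_norm T g' \<le> ereal (\<alpha> i)" if i: "i \<in> {1..m}" for i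
  proof -
    obtain g' where g': "g' \<in> borel_measurable (lebesgue_on {0..T})" "\<And>t. norm (g' t) \<le> \<alpha> i"
        "weak_limit T (\<lambda>n. g (r (s n)) i) g'"
      using s(2)[of i] i by (auto simp: W_def)
    have "(\<lambda>t. g' t $ j) \<in> L_infty T" for j
    proof (rule L_inftyI)
      show "(\<lambda>t. g' t $ j) \<in> borel_measurable (lebesgue_on {0..T})"
        using borel_measurable_inner[OF g'(1) borel_measurable_const[of "axis j 1"]] by (simp add: inner_axis)
      show "\<bar>g' t $ j\<bar> \<le> \<alpha> i" for t
        using component_le_norm_cart g'(2) by (rule order_trans)
    qed
    moreover have "has_weak_deriv T i (\<lambda>t. Q t $ j) (\<lambda>t. g' t $ j)" for j
    proof (rule has_weak_deriv_limit[OF _ Q q_bound lims _ g'(3)])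
      show "continuous_on {0..T} (q (r (s n)))" for n
        using lip by (rule lipschitz_on_continuous_on)
      show "has_weak_deriv T i (\<lambda>t. q (r (s n)) t $ j) (\<lambda>t. g (r (s n)) i t $ j)" for n
        using i by (rule g)
    qed
    moreover have "ess_norm T g' \<le> ereal (\<alpha> i)"
      using g'(1,2) by (rule ess_norm_leI)
    ultimately show ?thesis by blast
  qed
  have Q_bound: "norm (Q t) \<le> B" if "t \<in> {0..T}" for t
    using tendsto_norm[OF lim'[OF that]] q_bound[OF that] by (intro LIMSEQ_le_const2) auto
  have "(\<lambda>t. Q t $ j) \<in> sobolev_infty T m" for j
    unfolding sobolev_infty_def
  proof (intro CollectI conjI ballI)
    show "(\<lambda>t. Q t $ j) \<in> L_infty T"
    proof (rule L_inftyI)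
      show "(\<lambda>t. Q t $ j) \<in> borel_measurable (lebesgue_on {0..T})"
        using Q by (intro continuous_imp_measurable_on_sets_lebesgue continuous_on_component) auto
      show "\<bar>Q t $ j\<bar> \<le> B" if "t \<in> {0..T}" for t
        using component_le_norm_cart Q_bound[OF that] by (rule order_trans)
    qed
    show "\<exists>g\<in>L_infty T. has_weak_deriv T i (\<lambda>t. Q t $ j) g" if "i \<in> {1..m}" for i
      using weak[OF that] by blast
  qed
  then have curve: "(\<lambda>t. torus_proj (Q t)) \<in> curves T m \<alpha>"
    unfolding curves_def using Q weak by blast
  show thesis
  proof (rule that[OF strict_mono_o[OF r s(1)] curve])
    fix h :: "'d torus \<Rightarrow> real" and t assume h: "continuous_on UNIV h" and t: "t \<in> {0..T}"
    show "(\<lambda>n. h (p ((r \<circ> s) n) t)) \<longlonglongrightarrow> h (torus_proj (Q t))"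
      using continuous_on_tendsto_compose[OF continuous_on_compose_torus_proj[OF h] lims[OF t]]
      by (simp add: q[OF t])
  qed
qed

section \<open>Attainment of the infimum\<close>

lemma borel_measurable_curve:
  fixes p :: "real \<Rightarrow> ('d::finite) torus"
  assumes "p \<in> curves T m \<alpha>"
  shows "p \<in> borel_measurable (normalized_lebesgue T)"
proof -
  obtain q :: "real \<Rightarrow> real ^ 'd" where q: "continuous_on {0..T} q" "\<forall>t\<in>{0..T}. p t = torus_proj (q t)"
    using assms unfolding curves_def by blast
  have "q \<in> borel_measurable (lebesgue_on {0..T})"
    using q(1) by (intro continuous_imp_measurable_on_sets_lebesgue) auto
  then have "(\<lambda>t. torus_proj (q t)) \<in> borel_measurable (lebesgue_on {0..T})"
    using borel_measurable_continuous_onI[OF continuous_on_torus_proj] by (rule measurable_compose)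
  then have "p \<in> borel_measurable (lebesgue_on {0..T})"
    using q(2) by (subst measurable_cong[where g="\<lambda>t. torus_proj (q t)"]) (auto simp: space_restrict_space)
  then show ?thesis
    by (simp add: normalized_lebesgue_def cong: measurable_cong_sets)
qed

lemma prob_space_normalized_lebesgue: "0 < T \<Longrightarrow> prob_space (normalized_lebesgue T)"
  unfolding normalized_lebesgue_def
  by (intro prob_space_uniform_measure) (auto simp: emeasure_restrict_space)

text \<open>Provides a competitor, so that the infimum of the real set of discrepancies is taken
  over a nonempty set.\<close>

lemma constant_curve:
  assumes "\<And>i. i \<in> {1..m} \<Longrightarrow> 0 \<le> \<alpha> i"
  shows "(\<lambda>_. torus_proj (0 :: real ^ 'd::finite)) \<in> curves T m \<alpha>"
proof -
  have L: "(\<lambda>_. 0) \<in> L_infty T" by (rule L_inftyI[of _ _ 0]) auto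
  have weak: "has_weak_deriv T i (\<lambda>_. 0) (\<lambda>_. 0)" for i
    by (simp add: has_weak_deriv_def)
  have "(\<lambda>t. (0 :: real ^ 'd) $ j) \<in> sobolev_infty T m" for j
    using L weak by (auto simp: sobolev_infty_def)
  moreover have "\<exists>g :: real \<Rightarrow> real ^ 'd. (\<forall>j. (\<lambda>t. g t $ j) \<in> L_infty T \<and>
      has_weak_deriv T i (\<lambda>t. (0 :: real ^ 'd) $ j) (\<lambda>t. g t $ j)) \<and> ess_norm T g \<le> ereal (\<alpha> i)"
    if "i \<in> {1..m}" for i
    using L weak assms[OF that] by (intro exI[of _ "\<lambda>_. 0"]) (auto intro!: ess_norm_leI)
  ultimately show ?thesis
    unfolding curves_def using continuous_on_const
    by - (rule CollectI, rule exI[of _ "\<lambda>_. 0"], blast)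
qed

theorem theorem5:
  fixes h :: "('d::finite) torus \<Rightarrow> real" and \<pi> :: "'d torus measure"
    and T :: real and m :: nat and \<alpha> :: "nat \<Rightarrow> real"
  assumes "continuous_on UNIV h"
    and "\<And>\<xi> :: int ^ 'd. fourier_coeff h \<xi> \<noteq> 0"
    and "prob_space \<pi>" and "sets \<pi> = sets borel"
    and "T > 0"
    and "m \<ge> 1" and "\<And>i. i \<in> {1..m} \<Longrightarrow> \<alpha> i > 0"
  shows "\<exists>\<mu>\<in>curve_measures T m \<alpha>. \<forall>\<nu>\<in>curve_measures T m \<alpha>.
    conv_norm h (measure \<mu> - measure \<pi>) \<le> conv_norm h (measure \<nu> - measure \<pi>)"
proof -
  \<comment> \<open>The minimization is carried out over curves, where compactness was proved, and
    transferred to measures only at the end.\<close>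
  define F where "F p = conv_norm h (measure (distr (normalized_lebesgue T) borel p) - measure \<pi>)" for p
  let ?C = "curves T m \<alpha> :: (real \<Rightarrow> 'd torus) set"
  have \<alpha>: "0 \<le> \<alpha> i" if "i \<in> {1..m}" for i
    using assms(7)[OF that] by simp
  have ne: "F ` ?C \<noteq> {}"
    using constant_curve[where m=m and \<alpha>=\<alpha>, OF \<alpha>] by blast
  have bdd: "bdd_below (F ` ?C)"
    by (rule bdd_belowI[of _ 0]) (auto simp: F_def conv_norm_def L2_norm_def)
  define I where "I = Inf (F ` ?C)"
  have I_le: "I \<le> F p" if "p \<in> ?C" for p
    unfolding I_def using bdd that by (intro cInf_lower) auto
  have "\<exists>p\<in>?C. F p < I + 1 / real (Suc n)" for n
    using cInf_lessD[OF ne, of "I + 1 / real (Suc n)"] by (auto simp: I_def)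
  then have "\<forall>n. \<exists>p. p \<in> ?C \<and> F p < I + 1 / real (Suc n)" by blast
  from choice[OF this] obtain p where p: "\<And>n. p n \<in> ?C" "\<And>n. F (p n) < I + 1 / real (Suc n)"
    by blast
  obtain r p' where r: "strict_mono (r :: nat \<Rightarrow> nat)" and p': "p' \<in> ?C"
    and lim: "\<And>(h :: 'd torus \<Rightarrow> real) t. continuous_on UNIV h \<Longrightarrow> t \<in> {0..T} \<Longrightarrow> (\<lambda>n. h (p (r n) t)) \<longlonglongrightarrow> h (p' t)"
  proof (rule curves_sequentially_compact[where p=p, OF p(1) assms(5,6) \<alpha>])
    fix r p' assume *: "strict_mono (r :: nat \<Rightarrow> nat)" "p' \<in> ?C"
      "\<And>(h :: 'd torus \<Rightarrow> real) t. continuous_on UNIV h \<Longrightarrow> t \<in> {0..T} \<Longrightarrow> (\<lambda>n. h (p (r n) t)) \<longlonglongrightarrow> h (p' t)"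
    show thesis by (rule that[OF *])
  qed
  have "(\<lambda>n. F (p (r n))) \<longlonglongrightarrow> F p'"
    unfolding F_def
  proof (rule conv_norm_tendsto[OF assms(1) prob_space_normalized_lebesgue[OF assms(5)] assms(3,4)])
    \<comment> \<open>The convergence is applied to the reflected translate of \<open>h\<close> by
      \<open>x\<close>, itself continuous on the torus.\<close>
    show "(\<lambda>n. h (x - p (r n) t)) \<longlonglongrightarrow> h (x - p' t)" if "t \<in> space (normalized_lebesgue T)" for x t
      using that by (intro lim continuous_on_torus_translate assms(1))
        (simp add: normalized_lebesgue_def space_restrict_space)
  qed (use p(1) p' in \<open>auto intro: borel_measurable_curve\<close>)
  moreover have "(\<lambda>n. F (p (r n))) \<longlonglongrightarrow> I"
  proof (rule LIMSEQ_subseq_LIMSEQ[OF _ r, unfolded o_def])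
    show "(\<lambda>n. F (p n)) \<longlonglongrightarrow> I"
    proof (rule tendsto_sandwich[of "\<lambda>_. I"])
      show "(\<lambda>n. I + 1 / real (Suc n)) \<longlonglongrightarrow> I"
        using tendsto_add[OF tendsto_const LIMSEQ_inverse_real_of_nat, of I] by (simp add: inverse_eq_divide)
      show "\<forall>\<^sub>F n in sequentially. F (p n) \<le> I + 1 / real (Suc n)"
        using p(2) by (intro always_eventually allI less_imp_le)
    qed (use p(1) I_le in auto)
  qed
  ultimately have "F p' = I" by (rule LIMSEQ_unique)
  then show ?thesis
    using p' I_le by (auto simp: curve_measures_def F_def)
qed

end
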